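(* With probability one there exists $n_0$ such that for every $n\ge n_0$ the function $\mathbb R^3\ni(\alpha',\mu'_\varepsilon,\theta')\mapsto Q_n(\mathbf Y_n;\alpha',\mu'_\varepsilon,\theta')$ has a unique global minimizer, denoted $(\hat\alpha_n,\hat\mu_{\varepsilon,n},\hat\theta_n)$. Moreover, for every $(\alpha,\mu_\varepsilon,\theta)\in(0,1)\times(0,\infty)\times\mathbb N$, almost surely $\hat\alpha_n\to\alpha$, $\hat\mu_{\varepsilon,n}\to\mu_\varepsilon$ and $$\hat\theta_n\to Y_s-\frac{\alpha}{1+\alpha^2}(Y_{s-1}+Y_{s+1})-\frac{1-\alpha}{1+\alpha^2}\mu_\varepsilon\qquad(n\to\infty).$$
   Context: INAR(1) process: Let $\alpha\in(0,1)$. Let $(\varepsilon_k)_{k\in\mathbb N}$ be i.i.d. non-negative integer-valued random variables with $\mathbb E\varepsilon_1^2<\infty$ and $\mathbb P(\varepsilon_1\ne 0)>0$; write $\mu_\varepsilon=\mathbb E\varepsilon_1$ and $\sigma_\varepsilon^2=\operatorname{Var}\varepsilon_1$. For each $k\in\mathbb N$ let $(\xi_{k,j})_{j\in\mathbb N}$ be i.i.d. Bernoulli random variables with mean $\alpha$, these sequences being mutually independent and independent of $(\varepsilon_k)$. Let $X_0$ be a non-negative integer-valued random variable with $\mathbb E X_0^2<\infty$, independent of all $\xi_{k,j}$ and $\varepsilon_k$, and set $X_k=\sum_{j=1}^{X_{k-1}}\xi_{k,j}+\varepsilon_k$ for $k\in\mathbb N$. Additive outlier: fix a known time $s\in\mathbb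 N$ and size $\theta\in\mathbb N$, and let $Y_k=X_k+\delta_{k,s}\theta$, $k\in\mathbb Z_+$. Write $\mathbf Y_n=(Y_0,\dots,Y_n)$, $\mathbf y_n=(y_0,\dots,y_n)$. For $n\ge\max(3,s+1)$ and $\alpha',\mu'_\varepsilon,\theta'\in\mathbb R$, $$Q_n(\mathbf y_n;\alpha',\mu'_\varepsilon,\theta')=\sum_{\substack{k=1\\k\notin\{s,s+1\}}}^n(y_k-\alpha'y_{k-1}-\mu'_\varepsilon)^2+(y_s-\alpha'y_{s-1}-\mu'_\varepsilon-\theta')^2+(y_{s+1}-\alpha'y_s-\mu'_\varepsilon+\alpha'\theta')^2 .$$ *)

theory Defs
  imports "HOL-Probability.Probability"
begin

text \<open>Index type for the primitive random variables of the INAR(1) model: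
  the initial value X0, the innovations eps k, and the Bernoulli counting variables xi k j.\<close>
datatype inar_idx = IX0 | IEps nat | IXi nat nat

definition inar_family ::
  "('a \<Rightarrow> nat) \<Rightarrow> (nat \<Rightarrow> 'a \<Rightarrow> nat) \<Rightarrow> (nat \<Rightarrow> nat \<Rightarrow> 'a \<Rightarrow> nat) \<Rightarrow> inar_idx \<Rightarrow> 'a \<Rightarrow> nat" where
  "inar_family X0 eps xi i = (case i of IX0 \<Rightarrow> X0 | IEps k \<Rightarrow> eps k | IXi k j \<Rightarrow> xi k j)"

definition inar_indices :: "inar_idx set" where
  "inar_indices = {IX0} \<union> {IEps k | k. k \<ge> 1} \<union> {IXi k j | k j. k \<ge> 1 \<and> j \<ge> 1}"

fun inarX :: "('a \<Rightarrow> nat) \<Rightarrow> (nat \<Rightarrow> 'a \<Rightarrow> nat) \<Rightarrow> (nat \<Rightarrow> nat \<Rightarrow> 'a \<Rightarrow> nat) \<Rightarrow> nat \<Rightarrow> 'a \<Rightarrow> nat" where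
  "inarX X0 eps xi 0 \<omega> = X0 \<omega>"
| "inarX X0 eps xi (Suc k) \<omega> = (\<Sum>j = 1..inarX X0 eps xi k \<omega>. xi (Suc k) j \<omega>) + eps (Suc k) \<omega>"

definition inarY :: "('a \<Rightarrow> nat) \<Rightarrow> (nat \<Rightarrow> 'a \<Rightarrow> nat) \<Rightarrow> (nat \<Rightarrow> nat \<Rightarrow> 'a \<Rightarrow> nat) \<Rightarrow> nat \<Rightarrow> nat \<Rightarrow> nat \<Rightarrow> 'a \<Rightarrow> nat" where
  "inarY X0 eps xi s \<theta> k \<omega> = inarX X0 eps xi k \<omega> + (if k = s then \<theta> else 0)"

definition Qn :: "nat \<Rightarrow> nat \<Rightarrow> (nat \<Rightarrow> real) \<Rightarrow> real \<times> real \<times> real \<Rightarrow> real" where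
  "Qn s n y p = (case p of (a, m, t) \<Rightarrow>
     (\<Sum>k \<in> {1..n} - {s, s+1}. (y k - a * y (k-1) - m)\<^sup>2)
     + (y s - a * y (s-1) - m - t)\<^sup>2
     + (y (s+1) - a * y s - m + a * t)\<^sup>2)"

definition is_unique_min :: "(real \<times> real \<times> real \<Rightarrow> real) \<Rightarrow> bool" where
  "is_unique_min f = (\<exists>!p. \<forall>q. f p \<le> f q)"

text \<open>The minimizer (meaningful when it is unique).\<close>
definition argminQ :: "nat \<Rightarrow> nat \<Rightarrow> (nat \<Rightarrow> real) \<Rightarrow> real \<times> real \<times> real" where
  "argminQ s n y = (THE p. \<forall>q. Qn s n y p \<le> Qn s n y q)"

end

theory Submission
  imports Defs
begin

text \<open>
  Write \<open>r k = X k - \<alpha> * X (k - 1) - \<mu>\<close>. Minimizing over \<open>t\<close> first and expanding around the true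
  parameter, every near-minimizer \<open>(a, m)\<close> is forced towards \<open>(\<alpha>, \<mu>)\<close> as soon as the averages of
  \<open>r k\<close> and \<open>r k * X (k - 1)\<close> vanish and the design matrix grows linearly; near the true parameter
  the linear growth also beats the nonconvexity of the outlier term, whence uniqueness. The averages
  vanish by a strong law for martingale differences (Kolmogorov's maximal inequality along dyadic
  blocks). The design matrix needs no ergodic theorem: \<open>X\<close> is often bounded because its averages
  are, hence it visits some \<open>e \<ge> 1\<close> in the support of the innovations with positive frequency, and
  from there \<open>e + 1\<close>; two visited points make the design nondegenerate.
\<close>

section \<open>A strong law for square-integrable martingale differences\<close>

text \<open>Existence, uniqueness and location of the minimizer are settled path by path:
  \<open>outlier_regression\<close> contains no probability, and the process only has to supply its
  hypotheses on a set of full measure. The residuals at k = s and k = s + 1 are the only ones that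
  contain t and the only ones that see the perturbed value of Y at s. Hence the rest of
  \<open>Qn\<close> is a functional of X alone, while the estimator of the outlier size gains
  nothing from large n except good values of a and m: it tends to the t that fits these two
  residuals best at the true (\<alpha>, \<mu>), which is the random limit in the theorem. The
  obstacle to uniqueness is the product a * t, which makes \<open>Qn\<close> a polynomial of degree
  four, so that the minimizer is not the solution of a linear system. The obstacle in probability is
  the lack of moments: only second moments of X are available, bounded in k because \<alpha> < 1.
  The strong law is therefore stated for variances growing like k to a power \<gamma> < 1, which
  leaves room for truncated products.\<close>

locale square_integrable_martingale_differences = prob_space M
  for M :: "'a measure" +
  fixes F :: "nat \<Rightarrow> 'a measure" and D :: "nat \<Rightarrow> 'a \<Rightarrow> real"
  assumes F_space: "space (F k) = space M"
    and F_subset: "sets (F k) \<subseteq> sets M"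
    and F_mono: "sets (F k) \<subseteq> sets (F (Suc k))"
    and D_adapted: "D (Suc k) \<in> borel_measurable (F (Suc k))"
    and D_square_integrable: "integrable M (\<lambda>\<omega>. (D (Suc k) \<omega>)\<^sup>2)"
    and D_orthogonal: "\<And>Z. Z \<in> borel_measurable (F k) \<Longrightarrow> bounded (range Z) \<Longrightarrow>
      expectation (\<lambda>\<omega>. Z \<omega> * D (Suc k) \<omega>) = 0"
begin

text \<open>Freezing the partial sums once they reach level \<open>l\<close> does not increase the second moment, so
  Chebyshev's inequality for the frozen sum already gives the maximal inequality.\<close>

primrec stopped_sum :: "real \<Rightarrow> nat \<Rightarrow> 'a \<Rightarrow> real" where
  "stopped_sum l 0 \<omega> = 0"
| "stopped_sum l (Suc k) \<omega> =
    stopped_sum l k \<omega> + (if l \<le> \<bar>stopped_sum l k \<omega>\<bar> then 0 else D (Suc k) \<omega>)"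

lemma measurable_F_Suc: "f \<in> borel_measurable (F k) \<Longrightarrow> f \<in> borel_measurable (F (Suc k))"
  using F_mono[of k] by (auto simp: measurable_def F_space)

lemma measurable_F_M: "f \<in> borel_measurable (F k) \<Longrightarrow> f \<in> borel_measurable M"
  using F_subset[of k] by (auto simp: measurable_def F_space)

lemma stopped_sum_adapted: "stopped_sum l k \<in> borel_measurable (F k)"
proof (induction k)
  case (Suc k)
  have [measurable]: "stopped_sum l k \<in> borel_measurable (F (Suc k))" "D (Suc k) \<in> borel_measurable (F (Suc k))"
    using Suc measurable_F_Suc D_adapted by auto
  show ?case by (simp only: stopped_sum.simps) measurable
qed simp

lemma D_measurable: "D (Suc k) \<in> borel_measurable M"
  using measurable_F_M D_adapted by blast

text \<open>The decision to freeze depends on the past only. In the expanded square the cross term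
  is thus D against a weight measurable in the past, and vanishes; the square of the new increment
  contributes at most the variance of D.\<close>

lemma stopped_sum_second_moment:
  "integrable M (\<lambda>\<omega>. (stopped_sum l k \<omega>)\<^sup>2) \<and>
   expectation (\<lambda>\<omega>. (stopped_sum l k \<omega>)\<^sup>2) \<le> (\<Sum>i=1..k. expectation (\<lambda>\<omega>. (D i \<omega>)\<^sup>2))"
proof (induction k)
  case (Suc k)
  define T where "T = stopped_sum l k"
  define Z where "Z = (\<lambda>\<omega>. if l \<le> \<bar>T \<omega>\<bar> then 0 else T \<omega>)"
  define R where "R = (\<lambda>\<omega>. if l \<le> \<bar>T \<omega>\<bar> then 0 else (D (Suc k) \<omega>)\<^sup>2)"
  have T [measurable]: "T \<in> borel_measurable (F k)" and TM [measurable]: "T \<in> borel_measurable M"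
    unfolding T_def using stopped_sum_adapted measurable_F_M by blast+
  note [measurable] = D_measurable[of k]
  have Z: "Z \<in> borel_measurable (F k)" and ZM [measurable]: "Z \<in> borel_measurable M"
    unfolding Z_def by measurable
  have Zb: "\<bar>Z \<omega>\<bar> \<le> \<bar>l\<bar>" for \<omega> by (auto simp: Z_def)
  \<comment> \<open>Freezing at level l is what bounds the weight, so orthogonality to bounded
    weights, as assumed in the locale in place of a conditional expectation, suffices.\<close>
  have "bounded (range Z)" using Zb by (auto simp: bounded_iff)
  then have orth: "expectation (\<lambda>\<omega>. Z \<omega> * D (Suc k) \<omega>) = 0" using D_orthogonal Z by blast
  have D1: "integrable M (D (Suc k))"
    by (rule square_integrable_imp_integrable) (use D_square_integrable in auto)
  have intZ: "integrable M (\<lambda>\<omega>. Z \<omega> * D (Suc k) \<omega>)"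
    by (rule Bochner_Integration.integrable_bound[OF integrable_mult_right[OF integrable_abs[OF D1], of "\<bar>l\<bar>"]])
       (auto simp: abs_mult intro!: mult_right_mono Zb)
  have intR: "integrable M R"
    unfolding R_def by (rule Bochner_Integration.integrable_bound[OF D_square_integrable[of k]]) auto
  have leR: "expectation R \<le> expectation (\<lambda>\<omega>. (D (Suc k) \<omega>)\<^sup>2)"
    by (rule integral_mono[OF intR D_square_integrable]) (auto simp: R_def)
  have eq: "(stopped_sum l (Suc k) \<omega>)\<^sup>2 = (T \<omega>)\<^sup>2 + 2 * (Z \<omega> * D (Suc k) \<omega>) + R \<omega>" for \<omega>
    by (auto simp: Z_def R_def T_def power2_eq_square algebra_simps)
  have IH: "integrable M (\<lambda>\<omega>. (T \<omega>)\<^sup>2)"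
    "expectation (\<lambda>\<omega>. (T \<omega>)\<^sup>2) \<le> (\<Sum>i=1..k. expectation (\<lambda>\<omega>. (D i \<omega>)\<^sup>2))"
    using Suc by (auto simp: T_def)
  have "expectation (\<lambda>\<omega>. (stopped_sum l (Suc k) \<omega>)\<^sup>2)
      = expectation (\<lambda>\<omega>. (T \<omega>)\<^sup>2) + 2 * expectation (\<lambda>\<omega>. Z \<omega> * D (Suc k) \<omega>) + expectation R"
    unfolding eq using IH intZ intR by simp
  also have "\<dots> \<le> (\<Sum>i=1..Suc k. expectation (\<lambda>\<omega>. (D i \<omega>)\<^sup>2))"
    using IH(2) orth leR by simp
  finally show ?case unfolding eq using IH intZ intR by simp
qed simp

text \<open>A frozen sum keeps the value at which it first reached l. So if any partial sum up to
  time k reaches l, the stopped sum at the final time k shows it.\<close>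

lemma stopped_sum_cases:
  "(stopped_sum l k \<omega> = (\<Sum>i=1..k. D i \<omega>) \<and> (\<forall>j\<le>k. \<bar>\<Sum>i=1..j. D i \<omega>\<bar> < l)) \<or>
   l \<le> \<bar>stopped_sum l k \<omega>\<bar>"
  by (induction k) (auto simp: le_Suc_eq)

theorem kolmogorov_maximal_inequality:
  assumes "0 < l"
  shows "prob {\<omega> \<in> space M. \<exists>j\<le>n. l \<le> \<bar>\<Sum>i=1..j. D i \<omega>\<bar>}
    \<le> (\<Sum>i=1..n. expectation (\<lambda>\<omega>. (D i \<omega>)\<^sup>2)) / l\<^sup>2"
proof -
  have [measurable]: "stopped_sum l n \<in> borel_measurable M"
    using stopped_sum_adapted measurable_F_M by blast
  have "prob {\<omega> \<in> space M. \<exists>j\<le>n. l \<le> \<bar>\<Sum>i=1..j. D i \<omega>\<bar>}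
      \<le> prob {\<omega> \<in> space M. l\<^sup>2 \<le> (stopped_sum l n \<omega>)\<^sup>2}"
  proof (rule finite_measure_mono)
    show "{\<omega> \<in> space M. \<exists>j\<le>n. l \<le> \<bar>\<Sum>i=1..j. D i \<omega>\<bar>} \<subseteq> {\<omega> \<in> space M. l\<^sup>2 \<le> (stopped_sum l n \<omega>)\<^sup>2}"
      using stopped_sum_cases[of l n] \<open>0 < l\<close>
      by (auto simp: abs_le_square_iff[symmetric]) (metis not_le)
  qed simp
  also have "\<dots> \<le> expectation (\<lambda>\<omega>. (stopped_sum l n \<omega>)\<^sup>2) / l\<^sup>2"
    using stopped_sum_second_moment[of l n] \<open>0 < l\<close>
    by (intro integral_Markov_inequality_measure[where A="{}"]) auto
  also have "\<dots> \<le> (\<Sum>i=1..n. expectation (\<lambda>\<omega>. (D i \<omega>)\<^sup>2)) / l\<^sup>2"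
    using stopped_sum_second_moment[of l n] by (intro divide_right_mono) auto
  finally show ?thesis .
qed

text \<open>Up to time N = 2^(j+1) the variances sum to at most C * N^(1+\<gamma>), and the maximal
  inequality divides this by (\<epsilon> * 2^j)^2. The quotient is geometric in j since \<gamma> <
  1, so Borel-Cantelli applies along dyadic blocks.\<close>

theorem strong_law_of_large_numbers:
  fixes C \<gamma> :: real
  assumes \<gamma>: "0 \<le> \<gamma>" "\<gamma> < 1"
    and bound: "\<And>k. expectation (\<lambda>\<omega>. (D (Suc k) \<omega>)\<^sup>2) \<le> C * real (Suc k) powr \<gamma>"
  shows "AE \<omega> in M. (\<lambda>n. (\<Sum>k=1..n. D k \<omega>) / n) \<longlonglongrightarrow> 0"
proof -
  define S where "S = (\<lambda>n \<omega>. \<Sum>i=1..n. D i \<omega>)"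
  have [measurable]: "D i \<in> borel_measurable M" if "i \<ge> 1" for i
    using D_measurable[of "i - 1"] that by simp
  have [measurable]: "S n \<in> borel_measurable M" for n
    unfolding S_def by (intro borel_measurable_sum) simp
  have "0 \<le> expectation (\<lambda>\<omega>. (D (Suc 0) \<omega>)\<^sup>2)" by simp
  also have "\<dots> \<le> C" using bound[of 0] by simp
  finally have C: "0 \<le> C" .
  \<comment> \<open>The geometric ratio of the block probabilities: 2^((j+1)(1+\<gamma>)) is at most
    4 * 4^j * q^j.\<close>
  define q where "q = (2::real) powr (\<gamma> - 1)"
  have q: "0 < q" "q < 1" using \<gamma> by (auto simp: q_def powr_less_one)
  \<comment> \<open>The range reaches 2^(j+1) but the level is only \<epsilon> * 2^j, so outside
    this event the average stays below \<epsilon> for every n in the block from 2^j to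
    2^(j+1).\<close>
  define A where "A = (\<lambda>\<epsilon> j. {\<omega> \<in> space M. \<exists>i\<le>2^(Suc j). \<epsilon> * 2^j \<le> \<bar>S i \<omega>\<bar>})"
  have A_meas: "A \<epsilon> j \<in> sets M" for \<epsilon> j
    unfolding A_def by measurable
  have A_prob: "prob (A \<epsilon> j) \<le> (C * 4 / \<epsilon>\<^sup>2) * q ^ j" if "0 < \<epsilon>" for \<epsilon> :: real and j
  proof -
    let ?N = "2 ^ Suc j :: nat"
    have "(\<Sum>i=1..?N. expectation (\<lambda>\<omega>. (D i \<omega>)\<^sup>2)) \<le> (\<Sum>i=1..?N. C * real ?N powr \<gamma>)"
    proof (rule sum_mono)
      fix i assume i: "i \<in> {1..?N}"
      then have "expectation (\<lambda>\<omega>. (D i \<omega>)\<^sup>2) \<le> C * real i powr \<gamma>"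
        using bound[of "i - 1"] by simp
      also have "\<dots> \<le> C * real ?N powr \<gamma>"
        using i C \<gamma> by (intro mult_left_mono powr_mono2) (simp_all add: of_nat_le_iff del: of_nat_power power_Suc)
      finally show "expectation (\<lambda>\<omega>. (D i \<omega>)\<^sup>2) \<le> C * real ?N powr \<gamma>" .
    qed
    also have "\<dots> = C * (real ?N * real ?N powr \<gamma>)" by simp
    also have "\<dots> \<le> C * (4 * 4 ^ j * q ^ j)"
    proof (intro mult_left_mono C)
      have N: "real ?N = 2 powr (real j + 1)"
        by (simp add: powr_add powr_realpow)
      have "real ?N * real ?N powr \<gamma> = 2 powr ((real j + 1) * (1 + \<gamma>))"
        unfolding N by (simp add: powr_powr powr_add[symmetric] algebra_simps)
      also have "\<dots> \<le> 2 powr (2 + (2 * real j + (\<gamma> - 1) * real j))"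
        using \<gamma> by (intro powr_mono) (auto simp: algebra_simps)
      also have "\<dots> = 4 * 4 ^ j * q ^ j"
      proof -
        have "(2::real) powr (2 * real j) = 4 ^ j"
          using powr_powr[of "2::real" 2 "real j"] by (simp add: powr_realpow)
        moreover have "(2::real) powr ((\<gamma> - 1) * real j) = q ^ j"
          unfolding q_def by (simp add: powr_powr[symmetric] powr_realpow)
        ultimately show ?thesis by (simp add: powr_add)
      qed
      finally show "real ?N * real ?N powr \<gamma> \<le> 4 * 4 ^ j * q ^ j" .
    qed
    finally have *: "(\<Sum>i=1..?N. expectation (\<lambda>\<omega>. (D i \<omega>)\<^sup>2)) \<le> C * (4 * 4 ^ j * q ^ j)" .
    have "prob (A \<epsilon> j) \<le> (\<Sum>i=1..?N. expectation (\<lambda>\<omega>. (D i \<omega>)\<^sup>2)) / (\<epsilon> * 2 ^ j)\<^sup>2"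
      unfolding A_def S_def using that by (intro kolmogorov_maximal_inequality) auto
    also have "\<dots> \<le> C * (4 * 4 ^ j * q ^ j) / (\<epsilon> * 2 ^ j)\<^sup>2"
      using * by (intro divide_right_mono) auto
    also have "(\<epsilon> * 2 ^ j)\<^sup>2 = \<epsilon>\<^sup>2 * 4 ^ j"
      by (simp add: power_mult_distrib power2_eq_square flip: power_mult_distrib)
    finally show ?thesis using that by (simp add: field_simps)
  qed
  \<comment> \<open>The tolerances 1/(m+1) are countably many, so the exceptional null sets can be
    united.\<close>
  have "AE \<omega> in M. eventually (\<lambda>j. \<omega> \<in> space M - A (1 / real (Suc m)) j) sequentially" for m
  proof (rule borel_cantelli_AE1)
    show "summable (\<lambda>j. prob (A (1 / real (Suc m)) j))"
      by (rule summable_comparison_test'[where N=0 and g="\<lambda>j. (C * 4 / (1 / real (Suc m))\<^sup>2) * q ^ j"])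
         (use A_prob[of "1 / real (Suc m)"] q in \<open>auto intro!: summable_mult summable_geometric\<close>)
  qed (use A_meas in \<open>auto simp: emeasure_eq_measure\<close>)
  then have "AE \<omega> in M. \<forall>m. eventually (\<lambda>j. \<omega> \<in> space M - A (1 / real (Suc m)) j) sequentially"
    by (simp add: AE_all_countable)
  then have "AE \<omega> in M. (\<lambda>n. S n \<omega> / real n) \<longlonglongrightarrow> 0"
  proof (eventually_elim, intro LIMSEQ_I)
    fix \<omega> and r :: real
    assume ev: "\<forall>m. eventually (\<lambda>j. \<omega> \<in> space M - A (1 / real (Suc m)) j) sequentially" and r: "0 < r"
    obtain m where m: "1 / real (Suc m) < r" using r reals_Archimedean by (auto simp: inverse_eq_divide)
    obtain J where J: "\<And>j. j \<ge> J \<Longrightarrow> \<omega> \<in> space M - A (1 / real (Suc m)) j"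
      using ev unfolding eventually_sequentially by blast
    show "\<exists>n0. \<forall>n\<ge>n0. norm (S n \<omega> / real n - 0) < r"
    proof (intro exI allI impI)
      fix n :: nat assume n: "n \<ge> 2 ^ J"
      then have n0: "n > 0" by (metis gr0I not_le zero_less_numeral zero_less_power)
      obtain j where j: "2 ^ j \<le> n" "n < 2 ^ (Suc j)"
        using ex_power_ivl1[of 2 n] n0 by auto
      have "J \<le> j"
      proof (rule ccontr)
        assume "\<not> J \<le> j"
        then have "(2::nat) ^ Suc j \<le> 2 ^ J" by (intro power_increasing) auto
        with n j show False by linarith
      qed
      then have "\<not> 1 / real (Suc m) * 2 ^ j \<le> \<bar>S n \<omega>\<bar>"
        using J[OF \<open>J \<le> j\<close>] less_imp_le[OF j(2)] unfolding A_def by blast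
      then have "\<bar>S n \<omega>\<bar> < 1 / real (Suc m) * 2 ^ j" by simp
      also have "\<dots> \<le> 1 / real (Suc m) * real n"
      proof (rule mult_left_mono)
        show "2 ^ j \<le> real n"
          using of_nat_mono[OF j(1), where 'a=real] by simp
      qed simp
      finally have "\<bar>S n \<omega>\<bar> / real n < 1 / real (Suc m)"
        using n0 by (simp add: field_simps)
      then show "norm (S n \<omega> / real n - 0) < r" using m by simp
    qed
  qed
  then show ?thesis by (simp add: S_def)
qed

end

section \<open>Least squares with an additive outlier\<close>

text \<open>Here y is one fixed path. The first two hypotheses say that the averaged normal
  equations hold asymptotically at (\<alpha>, \<mu>); \<open>design\<close> bounds the smallest
  eigenvalue of the Gram matrix of the regressors y (k-1) and 1 below by c * n.\<close>

locale outlier_regression =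
  fixes s :: nat and y :: "nat \<Rightarrow> real" and \<alpha> \<mu> c :: real
  assumes residual_mean:
      "(\<lambda>n. (\<Sum>k\<in>{1..n} - {s, s+1}. y k - \<alpha> * y (k-1) - \<mu>) / n) \<longlonglongrightarrow> 0"
    and residual_covariance:
      "(\<lambda>n. (\<Sum>k\<in>{1..n} - {s, s+1}. (y k - \<alpha> * y (k-1) - \<mu>) * y (k-1)) / n) \<longlonglongrightarrow> 0"
    and c_pos: "0 < c"
    and design: "eventually (\<lambda>n. \<forall>u v.
      c * n * (u\<^sup>2 + v\<^sup>2) \<le> (\<Sum>k\<in>{1..n} - {s, s+1}. (u * y (k-1) + v)\<^sup>2)) sequentially"
begin

definition outlier_part :: "real \<Rightarrow> real \<Rightarrow> real \<Rightarrow> real" where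
  "outlier_part a m t = (y s - a * y (s-1) - m - t)\<^sup>2 + (y (s+1) - a * y s - m + a * t)\<^sup>2"

text \<open>The least squares solution t of the two equations t = A and - a * t = B, where A and B
  are the residuals at s and s+1 without t: t = (A - a * B) / (1 + a^2).\<close>

definition outlier_fit :: "real \<Rightarrow> real \<Rightarrow> real" where
  "outlier_fit a m = y s - a / (1 + a\<^sup>2) * (y (s-1) + y (s+1)) - (1 - a) / (1 + a\<^sup>2) * m"

definition regular_part :: "nat \<Rightarrow> real \<Rightarrow> real \<Rightarrow> real" where
  "regular_part n a m = (\<Sum>k\<in>{1..n} - {s, s+1}. (y k - a * y (k-1) - m)\<^sup>2)"

text \<open>The bound on the squared distance to (\<alpha>, \<mu>) that
  \<open>sublevel_localized\<close> produces, solved for that distance.\<close>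

definition radius :: "nat \<Rightarrow> real" where
  "radius n = 2 / c * (outlier_part \<alpha> \<mu> (outlier_fit \<alpha> \<mu>) / n +
     2 / c * (((\<Sum>k\<in>{1..n} - {s, s+1}. y k - \<alpha> * y (k-1) - \<mu>) / n)\<^sup>2 +
       ((\<Sum>k\<in>{1..n} - {s, s+1}. (y k - \<alpha> * y (k-1) - \<mu>) * y (k-1)) / n)\<^sup>2))"

lemma Qn_split: "Qn s n y (a, m, t) = regular_part n a m + outlier_part a m t"
  by (simp add: Qn_def regular_part_def outlier_part_def)

lemma outlier_part_nonneg: "0 \<le> outlier_part a m t"
  by (simp add: outlier_part_def)

lemma outlier_part_complete_square:
  "outlier_part a m t = outlier_part a m (outlier_fit a m) + (1 + a\<^sup>2) * (t - outlier_fit a m)\<^sup>2"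
proof -
  define p where "p = outlier_fit a m"
  have "1 + a\<^sup>2 \<noteq> 0" by (smt (verit) zero_le_power2)
  then have "(1 + a\<^sup>2) * p = (y s - a * y (s-1) - m) - a * (y (s+1) - a * y s - m)"
    by (simp add: p_def outlier_fit_def divide_simps) (simp add: algebra_simps power2_eq_square)
  then show ?thesis
    unfolding outlier_part_def p_def[symmetric] by algebra
qed

lemma outlier_part_ge: "outlier_part a m (outlier_fit a m) \<le> outlier_part a m t"
  unfolding outlier_part_complete_square[of a m t] by simp

lemma outlier_part_eqD:
  assumes "outlier_part a m t \<le> outlier_part a m (outlier_fit a m)"
  shows "t = outlier_fit a m"
proof -
  have "(1 + a\<^sup>2) * (t - outlier_fit a m)\<^sup>2 \<le> 0"
    using assms unfolding outlier_part_complete_square[of a m t] by simp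
  moreover have "0 < 1 + a\<^sup>2" by (smt (verit) zero_le_power2)
  ultimately show ?thesis by (simp add: mult_le_0_iff)
qed

text \<open>Exact Taylor expansion of a quadratic at (\<alpha>, \<mu>): the linear coefficients are
  the sums made small by the laws of large numbers, the quadratic term is the design form.\<close>

lemma regular_part_expand:
  "regular_part n a m = regular_part n \<alpha> \<mu>
    - 2 * (a - \<alpha>) * (\<Sum>k\<in>{1..n} - {s, s+1}. (y k - \<alpha> * y (k-1) - \<mu>) * y (k-1))
    - 2 * (m - \<mu>) * (\<Sum>k\<in>{1..n} - {s, s+1}. y k - \<alpha> * y (k-1) - \<mu>)
    + (\<Sum>k\<in>{1..n} - {s, s+1}. ((a - \<alpha>) * y (k-1) + (m - \<mu>))\<^sup>2)"
  unfolding regular_part_def sum_distrib_left sum_subtractf[symmetric] sum.distrib[symmetric]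
  by (rule sum.cong) (auto simp: power2_eq_square algebra_simps)

lemma radius_tendsto: "radius \<longlonglongrightarrow> 0"
proof -
  have "radius \<longlonglongrightarrow> 2 / c * (0 + 2 / c * (0\<^sup>2 + 0\<^sup>2))"
    unfolding radius_def
    by (intro tendsto_intros residual_mean residual_covariance lim_const_over_n)
  then show ?thesis by simp
qed

text \<open>Dropping the nonnegative outlier part on the left makes the estimate uniform in t. The
  design form is then bounded by a constant plus the linear terms, which are absorbed into half of
  the curvature c * n.\<close>

lemma sublevel_localized:
  "eventually (\<lambda>n. \<forall>a m t. Qn s n y (a, m, t) \<le> Qn s n y (\<alpha>, \<mu>, outlier_fit \<alpha> \<mu>)
     \<longrightarrow> (a - \<alpha>)\<^sup>2 + (m - \<mu>)\<^sup>2 \<le> radius n) sequentially"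
  using design eventually_gt_at_top[of 0]
proof (eventually_elim, intro allI impI)
  fix n :: nat and a m t
  assume *: "\<forall>u v. c * n * (u\<^sup>2 + v\<^sup>2) \<le> (\<Sum>k\<in>{1..n} - {s, s+1}. (u * y (k-1) + v)\<^sup>2)" and n: "0 < n"
    and le: "Qn s n y (a, m, t) \<le> Qn s n y (\<alpha>, \<mu>, outlier_fit \<alpha> \<mu>)"
  define u v where "u = a - \<alpha>" and "v = m - \<mu>"
  define e1 where "e1 = (\<Sum>k\<in>{1..n} - {s, s+1}. y k - \<alpha> * y (k-1) - \<mu>) / n"
  define e2 where "e2 = (\<Sum>k\<in>{1..n} - {s, s+1}. (y k - \<alpha> * y (k-1) - \<mu>) * y (k-1)) / n"
  define G where "G = outlier_part \<alpha> \<mu> (outlier_fit \<alpha> \<mu>)"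
  have s1: "(\<Sum>k\<in>{1..n} - {s, s+1}. y k - \<alpha> * y (k-1) - \<mu>) = n * e1"
    and s2: "(\<Sum>k\<in>{1..n} - {s, s+1}. (y k - \<alpha> * y (k-1) - \<mu>) * y (k-1)) = n * e2"
    using n by (auto simp: e1_def e2_def)
  have "c * n * (u\<^sup>2 + v\<^sup>2) \<le> G + n * (2 * u * e2 + 2 * v * e1)"
    using le *[rule_format, of u v] outlier_part_nonneg[of a m t]
    unfolding Qn_split regular_part_expand[of n a m] s1 s2 G_def u_def v_def
    by (simp add: algebra_simps)
  also have "\<dots> \<le> G + n * (c / 2 * u\<^sup>2 + 2 / c * e2\<^sup>2 + (c / 2 * v\<^sup>2 + 2 / c * e1\<^sup>2))"
  proof -
    \<comment> \<open>The weight c/2 on the square is chosen to leave the other half of the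
      curvature on the left.\<close>
    have amgm: "2 * x * e \<le> c / 2 * x\<^sup>2 + 2 / c * e\<^sup>2" for x e
    proof -
      have "0 \<le> (c * x - 2 * e)\<^sup>2 / (2 * c)" using c_pos by simp
      also have "\<dots> = c / 2 * x\<^sup>2 + 2 / c * e\<^sup>2 - 2 * x * e"
        using c_pos by (simp add: field_simps power2_eq_square)
      finally show ?thesis by simp
    qed
    show ?thesis by (intro add_left_mono mult_left_mono add_mono amgm) auto
  qed
  finally have "c / 2 * n * (u\<^sup>2 + v\<^sup>2) \<le> G + n * (2 / c * (e1\<^sup>2 + e2\<^sup>2))"
    by (simp add: algebra_simps)
  then have "u\<^sup>2 + v\<^sup>2 \<le> (G + n * (2 / c * (e1\<^sup>2 + e2\<^sup>2))) / (c / 2 * n)"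
    using n c_pos by (subst pos_le_divide_eq) (auto simp: mult_ac)
  also have "\<dots> = radius n"
    unfolding radius_def e1_def[symmetric] e2_def[symmetric] G_def[symmetric]
    using n c_pos by (simp add: field_simps)
  finally show "(a - \<alpha>)\<^sup>2 + (m - \<mu>)\<^sup>2 \<le> radius n" by (simp add: u_def v_def)
qed

section \<open>Existence of a minimizer\<close>

lemma continuous_on_outlier_fit:
  "continuous_on A (\<lambda>p. outlier_fit (fst p) (snd p))"
proof -
  have "1 + (fst p :: real)\<^sup>2 \<noteq> 0" for p :: "real \<times> real" by (smt (verit) zero_le_power2)
  then show ?thesis unfolding outlier_fit_def by (intro continuous_intros) auto
qed

text \<open>With t replaced by its best value, a continuous function of (a, m) remains, which
  attains its minimum on the compact unit ball; outside the ball every value exceeds the one at the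
  centre.\<close>

lemma minimizer_exists:
  assumes loc: "\<And>a m t. Qn s n y (a, m, t) \<le> Qn s n y (\<alpha>, \<mu>, outlier_fit \<alpha> \<mu>)
     \<Longrightarrow> (a - \<alpha>)\<^sup>2 + (m - \<mu>)\<^sup>2 \<le> 1"
  shows "\<exists>p. \<forall>q. Qn s n y p \<le> Qn s n y q"
proof -
  define K where "K = cball (\<alpha>, \<mu>) (1::real)"
  define f where "f = (\<lambda>p. Qn s n y (fst p, snd p, outlier_fit (fst p) (snd p)))"
  have "continuous_on K f"
    unfolding f_def Qn_split regular_part_def outlier_part_def
    by (intro continuous_intros continuous_on_outlier_fit)
  moreover have "compact K" "(\<alpha>, \<mu>) \<in> K" by (auto simp: K_def)
  ultimately obtain p where p: "p \<in> K" "\<And>q. q \<in> K \<Longrightarrow> f p \<le> f q"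
    using continuous_attains_inf[of K f] by blast
  have "f p \<le> Qn s n y (a, m, t)" for a m t
  proof (cases "Qn s n y (a, m, t) \<le> Qn s n y (\<alpha>, \<mu>, outlier_fit \<alpha> \<mu>)")
    case True
    then have "(a, m) \<in> K"
      using loc[of a m t] by (simp add: K_def dist_prod_def dist_real_def power2_commute[of \<alpha>] power2_commute[of \<mu>])
    then have "f p \<le> f (a, m)" by (rule p)
    also have "\<dots> \<le> Qn s n y (a, m, t)" by (simp add: f_def Qn_split outlier_part_ge)
    finally show ?thesis .
  next
    case False
    then show ?thesis using p(2)[of "(\<alpha>, \<mu>)"] \<open>(\<alpha>, \<mu>) \<in> K\<close> by (simp add: f_def)
  qed
  then show ?thesis by (metis f_def prod_cases3)
qed

lemma minimizer_outlier_fit: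
  assumes "\<And>q. Qn s n y (a, m, t) \<le> Qn s n y q"
  shows "t = outlier_fit a m"
  using assms[of "(a, m, outlier_fit a m)"] by (intro outlier_part_eqD) (simp add: Qn_split)

section \<open>Uniqueness of the minimizer\<close>

text \<open>Only the term \<open>a * t\<close> spoils the convexity of \<open>Qn\<close>, so the parallelogram identity
  at the midpoint holds up to the corrections in \<open>(a1 - a2) * (t1 - t2)\<close>.\<close>

lemma Qn_midpoint:
  fixes a1 a2 m1 m2 t1 t2 :: real
  defines "d \<equiv> (a1 - a2) * (t1 - t2) / 4"
    and "w \<equiv> (y (s+1) - a1 * y s - m1 + a1 * t1 + (y (s+1) - a2 * y s - m2 + a2 * t2)) / 2"
  shows "Qn s n y ((a1 + a2) / 2, (m1 + m2) / 2, (t1 + t2) / 2)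
    \<le> (Qn s n y (a1, m1, t1) + Qn s n y (a2, m2, t2)) / 2
      - ((\<Sum>k\<in>{1..n} - {s, s+1}. ((a1 - a2) * y (k-1) + (m1 - m2))\<^sup>2)
         + ((a1 - a2) * y (s-1) + (m1 - m2) + (t1 - t2))\<^sup>2) / 4 - 2 * w * d + d\<^sup>2"
proof -
  have sq: "((p + q) / 2)\<^sup>2 = (p\<^sup>2 + q\<^sup>2) / 2 - (p - q)\<^sup>2 / 4" for p q :: real
    by (simp add: power2_eq_square field_simps)
  have reg: "regular_part n ((a1 + a2) / 2) ((m1 + m2) / 2)
    = (regular_part n a1 m1 + regular_part n a2 m2) / 2
      - (\<Sum>k\<in>{1..n} - {s, s+1}. ((a1 - a2) * y (k-1) + (m1 - m2))\<^sup>2) / 4"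
    unfolding regular_part_def sum_divide_distrib sum.distrib[symmetric] sum_subtractf[symmetric]
    by (rule sum.cong) (auto simp: power2_eq_square field_simps)
  define A1 A2 where "A1 = y s - a1 * y (s-1) - m1 - t1" and "A2 = y s - a2 * y (s-1) - m2 - t2"
  define B1 B2 where "B1 = y (s+1) - a1 * y s - m1 + a1 * t1" and "B2 = y (s+1) - a2 * y s - m2 + a2 * t2"
  have o1: "y s - (a1 + a2) / 2 * y (s-1) - (m1 + m2) / 2 - (t1 + t2) / 2 = (A1 + A2) / 2"
    by (simp add: A1_def A2_def field_simps)
  \<comment> \<open>The product of the midpoints of a and t falls short of the midpoint of the
    products by exactly d.\<close>
  have o2: "y (s+1) - (a1 + a2) / 2 * y s - (m1 + m2) / 2 + (a1 + a2) / 2 * ((t1 + t2) / 2)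
     = (B1 + B2) / 2 - d"
    by (simp add: B1_def B2_def d_def field_simps)
  have w: "w = (B1 + B2) / 2" by (simp add: w_def B1_def B2_def)
  have A: "(A1 - A2)\<^sup>2 = ((a1 - a2) * y (s-1) + (m1 - m2) + (t1 - t2))\<^sup>2"
    unfolding A1_def A2_def by (simp add: power2_eq_square algebra_simps)
  have o: "outlier_part ((a1 + a2) / 2) ((m1 + m2) / 2) ((t1 + t2) / 2)
    = (A1\<^sup>2 + A2\<^sup>2) / 2 - (A1 - A2)\<^sup>2 / 4 + ((B1\<^sup>2 + B2\<^sup>2) / 2 - (B1 - B2)\<^sup>2 / 4 - 2 * w * d + d\<^sup>2)"
    unfolding outlier_part_def o1 o2 w sq[symmetric] by (simp add: power2_diff)
  \<comment> \<open>The convexity gain of the residual at s+1 is given away. That of the residual at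
    s is kept: t enters it with constant coefficient, so it controls t1 - t2.\<close>
  have B: "0 \<le> (B1 - B2)\<^sup>2 / 4" by simp
  have arith: "(R1 + R2) / 2 - S / 4 + o' \<le> (R1 + (p1 + q1) + (R2 + (p2 + q2))) / 2 - (S + X) / 4 - e + f"
    if "o' = (p1 + p2) / 2 - X / 4 + ((q1 + q2) / 2 - Y / 4 - e + f)" "0 \<le> Y / 4"
    for R1 R2 S o' p1 p2 q1 q2 X Y e f :: real
    using that(2) unfolding that(1) by simp argo
  show ?thesis
    unfolding Qn_split reg outlier_part_def[of a1] outlier_part_def[of a2]
      A1_def[symmetric] A2_def[symmetric] B1_def[symmetric] B2_def[symmetric] A[symmetric]
    by (rule arith[OF o B])
qed

text \<open>Compactness gives one constant, independent of n, for all quantities entering the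
  corrections at the midpoint.\<close>

lemma bounded_on_unit_ball:
  obtains T where "0 \<le> T"
    "\<And>a m. (a - \<alpha>)\<^sup>2 + (m - \<mu>)\<^sup>2 \<le> 1 \<Longrightarrow> \<bar>outlier_fit a m\<bar> \<le> T"
    "\<And>a m. (a - \<alpha>)\<^sup>2 + (m - \<mu>)\<^sup>2 \<le> 1 \<Longrightarrow> \<bar>y (s+1) - a * y s - m + a * outlier_fit a m\<bar> \<le> T"
    "\<And>a m. (a - \<alpha>)\<^sup>2 + (m - \<mu>)\<^sup>2 \<le> 1 \<Longrightarrow> \<bar>a\<bar> \<le> T"
proof -
  define K where "K = cball (\<alpha>, \<mu>) (1::real)"
  have K: "(a, m) \<in> K" if "(a - \<alpha>)\<^sup>2 + (m - \<mu>)\<^sup>2 \<le> 1" for a m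
    using that by (simp add: K_def dist_prod_def dist_real_def power2_commute[of \<alpha>] power2_commute[of \<mu>])
  define f where "f = (\<lambda>p. outlier_fit (fst p) (snd p))"
  define g where "g = (\<lambda>p. y (s+1) - fst p * y s - snd p + fst p * outlier_fit (fst p) (snd p))"
  have "continuous_on K f" "continuous_on K g" "continuous_on K (fst :: real \<times> real \<Rightarrow> real)"
    unfolding f_def g_def by (intro continuous_intros continuous_on_outlier_fit)+
  moreover have "compact K" by (simp add: K_def)
  ultimately have "bounded (f ` K)" "bounded (g ` K)" "bounded (fst ` K)"
    by (blast intro: compact_imp_bounded compact_continuous_image)+
  then obtain T1 T2 T3 where "\<forall>x\<in>K. \<bar>f x\<bar> \<le> T1" "\<forall>x\<in>K. \<bar>g x\<bar> \<le> T2" "\<forall>x\<in>K. \<bar>fst x\<bar> \<le> T3"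
    unfolding bounded_iff by auto
  then show ?thesis
    by (intro that[of "\<bar>T1\<bar> + \<bar>T2\<bar> + \<bar>T3\<bar>"]) (force dest!: K simp: f_def g_def)+
qed

text \<open>For two minimizers the value at the midpoint is no smaller, so the convexity gain is at
  most the correction. The correction is bounded by a multiple of |x| * |z|: its share in x is
  beaten by c * n, its share in z by the gain H of the residual at s.\<close>

lemma minimizer_unique:
  "eventually (\<lambda>n. \<forall>p q. (\<forall>r. Qn s n y p \<le> Qn s n y r) \<longrightarrow> (\<forall>r. Qn s n y q \<le> Qn s n y r) \<longrightarrow> p = q)
    sequentially"
proof -
  obtain T where T: "0 \<le> T"
    "\<And>a m. (a - \<alpha>)\<^sup>2 + (m - \<mu>)\<^sup>2 \<le> 1 \<Longrightarrow> \<bar>outlier_fit a m\<bar> \<le> T"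
    "\<And>a m. (a - \<alpha>)\<^sup>2 + (m - \<mu>)\<^sup>2 \<le> 1 \<Longrightarrow> \<bar>y (s+1) - a * y s - m + a * outlier_fit a m\<bar> \<le> T"
    "\<And>a m. (a - \<alpha>)\<^sup>2 + (m - \<mu>)\<^sup>2 \<le> 1 \<Longrightarrow> \<bar>a\<bar> \<le> T"
    using bounded_on_unit_ball by metis
  \<comment> \<open>\<open>W\<close> bounds |d| + 2 * |w|, \<open>h\<close> bounds both 1 and |y
    (s-1)|, and beyond \<open>N\<close> the curvature c * n exceeds all costs in x and v by at least
    1.\<close>
  define W where "W = 2 * T + T\<^sup>2"
  define h where "h = \<bar>y (s-1)\<bar> + 1"
  define N where "N = (W\<^sup>2 * 8 + 4 * h\<^sup>2 + 1) / c"
  have "eventually (\<lambda>n. radius n < 1) sequentially"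
    using radius_tendsto by (rule order_tendstoD) simp
  moreover have "eventually (\<lambda>n. N \<le> real n) sequentially"
    using filterlim_real_sequentially unfolding filterlim_at_top by blast
  ultimately show ?thesis
    using design sublevel_localized
  proof (eventually_elim, intro allI impI)
    fix n p q
    assume rad: "radius n < 1" and N: "N \<le> real n"
      and des: "\<forall>u v. c * n * (u\<^sup>2 + v\<^sup>2) \<le> (\<Sum>k\<in>{1..n} - {s, s+1}. (u * y (k-1) + v)\<^sup>2)"
      and loc: "\<forall>a m t. Qn s n y (a, m, t) \<le> Qn s n y (\<alpha>, \<mu>, outlier_fit \<alpha> \<mu>)
         \<longrightarrow> (a - \<alpha>)\<^sup>2 + (m - \<mu>)\<^sup>2 \<le> radius n"
      and minp: "\<forall>r. Qn s n y p \<le> Qn s n y r" and minq: "\<forall>r. Qn s n y q \<le> Qn s n y r"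
    obtain a1 m1 t1 where p: "p = (a1, m1, t1)" by (cases p)
    obtain a2 m2 t2 where q: "q = (a2, m2, t2)" by (cases q)
    \<comment> \<open>This brings t, on which the localization is silent, under the bound T.\<close>
    have t: "t1 = outlier_fit a1 m1" "t2 = outlier_fit a2 m2"
      using minimizer_outlier_fit minp minq unfolding p q by blast+
    have l: "(a1 - \<alpha>)\<^sup>2 + (m1 - \<mu>)\<^sup>2 \<le> 1" "(a2 - \<alpha>)\<^sup>2 + (m2 - \<mu>)\<^sup>2 \<le> 1"
      using loc[rule_format, of a1 m1 t1] loc[rule_format, of a2 m2 t2] minp minq rad unfolding p q
      by (meson less_imp_le order_trans)+
    define x v z where "x = a1 - a2" and "v = m1 - m2" and "z = t1 - t2"
    define d where "d = x * z / 4"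
    define w where "w = (y (s+1) - a1 * y s - m1 + a1 * t1 + (y (s+1) - a2 * y s - m2 + a2 * t2)) / 2"
    have avg: "\<bar>(b1 + b2) / 2\<bar> \<le> T" if "\<bar>b1\<bar> \<le> T" "\<bar>b2\<bar> \<le> T" for b1 b2
      using that by (simp add: abs_le_iff)
    have w: "\<bar>w\<bar> \<le> T"
      unfolding w_def t by (rule avg[OF T(3)[OF l(1)] T(3)[OF l(2)]])
    have x: "\<bar>x\<bar> \<le> 2 * T" using T(4)[OF l(1)] T(4)[OF l(2)] unfolding x_def by linarith
    have z: "\<bar>z\<bar> \<le> 2 * T" using T(2)[OF l(1)] T(2)[OF l(2)] unfolding z_def t by linarith
    have d: "\<bar>d\<bar> \<le> T\<^sup>2"
      using mult_mono[OF x z] T(1) by (simp add: d_def abs_mult power2_eq_square)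
    define H where "H = (x * y (s-1) + v + z)\<^sup>2"
    have "Qn s n y p \<le> Qn s n y ((a1 + a2) / 2, (m1 + m2) / 2, (t1 + t2) / 2)"
      using minp by blast
    also have "\<dots> \<le> (Qn s n y p + Qn s n y q) / 2
      - ((\<Sum>k\<in>{1..n} - {s, s+1}. (x * y (k-1) + v)\<^sup>2) + H) / 4 - 2 * w * d + d\<^sup>2"
      unfolding p q x_def v_def z_def d_def w_def H_def by (rule Qn_midpoint)
    also have "Qn s n y q = Qn s n y p" using minp minq by (meson order_antisym)
    finally have "c * n * (x\<^sup>2 + v\<^sup>2) + H \<le> 4 * (d\<^sup>2 - 2 * w * d)"
      using des[rule_format, of x v] by simp
    also have "\<dots> \<le> 4 * (\<bar>d\<bar> * W)"
    proof -
      have "d\<^sup>2 - 2 * w * d \<le> \<bar>d\<bar> * \<bar>d\<bar> + 2 * \<bar>w\<bar> * \<bar>d\<bar>"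
        using abs_ge_minus_self[of "2 * w * d"] by (simp add: abs_mult power2_eq_square)
      also have "\<dots> = \<bar>d\<bar> * (\<bar>d\<bar> + 2 * \<bar>w\<bar>)" by (simp add: algebra_simps)
      also have "\<dots> \<le> \<bar>d\<bar> * W" unfolding W_def using w d by (intro mult_left_mono) auto
      finally show ?thesis by simp
    qed
    also have "\<dots> = W * \<bar>x\<bar> * \<bar>z\<bar>" by (simp add: d_def abs_mult)
    \<comment> \<open>The weight 1/16 is small enough: by \<open>zH\<close> below, z^2 / 16 costs
      only H/8 of the H on the left, plus terms in x and v.\<close>
    also have "\<dots> \<le> 4 * W\<^sup>2 * x\<^sup>2 + z\<^sup>2 / 16"
    proof -
      have "0 \<le> (2 * (W * \<bar>x\<bar>) - \<bar>z\<bar> / 4)\<^sup>2" by simp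
      then have "4 * (W * \<bar>x\<bar>) * (\<bar>z\<bar> / 4) \<le> (2 * (W * \<bar>x\<bar>))\<^sup>2 + (\<bar>z\<bar> / 4)\<^sup>2"
        unfolding power2_diff by simp
      then show ?thesis by (simp add: power_mult_distrib power_divide mult.assoc)
    qed
    finally have main: "c * n * (x\<^sup>2 + v\<^sup>2) + H \<le> 4 * W\<^sup>2 * x\<^sup>2 + z\<^sup>2 / 16" .
    have zH: "z\<^sup>2 \<le> 2 * H + 4 * h\<^sup>2 * (x\<^sup>2 + v\<^sup>2)"
    proof -
      define b where "b = x * y (s-1) + v"
      have "H = (b + z)\<^sup>2" by (simp add: H_def b_def)
      then have "z\<^sup>2 \<le> 2 * H + 2 * b\<^sup>2"
        using zero_le_power2[of "z + 2 * b"] by (simp add: power2_eq_square algebra_simps)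
      moreover have "b\<^sup>2 \<le> 2 * h\<^sup>2 * (x\<^sup>2 + v\<^sup>2)"
      proof -
        have "b\<^sup>2 \<le> 2 * (x * y (s-1))\<^sup>2 + 2 * v\<^sup>2"
          using zero_le_power2[of "x * y (s-1) - v"] by (simp add: b_def power2_eq_square algebra_simps)
        also have "(x * y (s-1))\<^sup>2 \<le> h\<^sup>2 * x\<^sup>2"
        proof -
          have "(y (s-1))\<^sup>2 \<le> h\<^sup>2" by (subst abs_le_square_iff[symmetric]) (simp add: h_def)
          from mult_left_mono[OF this, of "x\<^sup>2"] show ?thesis
            by (simp add: power_mult_distrib mult.commute)
        qed
        also have "v\<^sup>2 \<le> h\<^sup>2 * v\<^sup>2"
        proof -
          have "1\<^sup>2 \<le> h\<^sup>2" by (rule power_mono) (auto simp: h_def)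
          from mult_right_mono[OF this, of "v\<^sup>2"] show ?thesis by simp
        qed
        finally show ?thesis by (simp add: algebra_simps)
      qed
      ultimately show ?thesis by linarith
    qed
    have "8 * (W\<^sup>2 * x\<^sup>2) + 4 * (h\<^sup>2 * (x\<^sup>2 + v\<^sup>2)) + (x\<^sup>2 + v\<^sup>2)
        \<le> (W\<^sup>2 * 8 + 4 * h\<^sup>2 + 1) * (x\<^sup>2 + v\<^sup>2)"
      by (simp add: distrib_left distrib_right)
    also have "\<dots> \<le> c * n * (x\<^sup>2 + v\<^sup>2)"
      using N c_pos by (intro mult_right_mono) (auto simp: N_def pos_divide_le_eq mult.commute)
    finally have "8 * (W\<^sup>2 * x\<^sup>2) + 4 * (h\<^sup>2 * (x\<^sup>2 + v\<^sup>2)) + (x\<^sup>2 + v\<^sup>2) \<le> c * n * (x\<^sup>2 + v\<^sup>2)" .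
    moreover have "0 \<le> W\<^sup>2 * x\<^sup>2" "0 \<le> h\<^sup>2 * (x\<^sup>2 + v\<^sup>2)" by auto
    moreover have "0 \<le> H" by (simp add: H_def)
    ultimately have "x\<^sup>2 + v\<^sup>2 + H / 2 \<le> 0"
      using main zH by linarith
    then have xv: "x\<^sup>2 = 0" "v\<^sup>2 = 0" "H = 0" using \<open>0 \<le> H\<close> zero_le_power2[of x] zero_le_power2[of v] by linarith+
    then have "z = 0" by (auto simp: H_def)
    with xv show "p = q" by (simp add: p q x_def v_def z_def)
  qed
qed

theorem eventually_unique_min: "eventually (\<lambda>n. is_unique_min (Qn s n y)) sequentially"
proof -
  have "eventually (\<lambda>n. radius n < 1) sequentially"
    using radius_tendsto by (rule order_tendstoD) simp
  then show ?thesis using sublevel_localized minimizer_unique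
  proof eventually_elim
    case (elim n)
    then have "\<exists>p. \<forall>q. Qn s n y p \<le> Qn s n y q"
      by (intro minimizer_exists) (meson less_imp_le order_trans)
    then show ?case unfolding is_unique_min_def using elim(3) by blast
  qed
qed

text \<open>The first two components are squeezed by \<open>radius\<close>; the third is the
  continuous function \<open>outlier_fit\<close> of them, with no averaging of its own.\<close>

theorem argmin_tendsto:
  "(\<lambda>n. fst (argminQ s n y)) \<longlonglongrightarrow> \<alpha>"
  "(\<lambda>n. fst (snd (argminQ s n y))) \<longlonglongrightarrow> \<mu>"
  "(\<lambda>n. snd (snd (argminQ s n y))) \<longlonglongrightarrow> outlier_fit \<alpha> \<mu>"
proof -
  define a m t where "a = (\<lambda>n. fst (argminQ s n y))" and "m = (\<lambda>n. fst (snd (argminQ s n y)))"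
    and "t = (\<lambda>n. snd (snd (argminQ s n y)))"
  \<comment> \<open>The \<open>THE\<close> in \<open>argminQ\<close> denotes a minimizer only once
    uniqueness holds, so every fact about the estimator is an eventual one.\<close>
  have min: "eventually (\<lambda>n. \<forall>q. Qn s n y (a n, m n, t n) \<le> Qn s n y q) sequentially"
    using eventually_unique_min
    by eventually_elim (auto simp: is_unique_min_def argminQ_def a_def m_def t_def dest!: theI')
  have fit: "eventually (\<lambda>n. outlier_fit (a n) (m n) = t n) sequentially"
    using min by eventually_elim (metis minimizer_outlier_fit)
  have loc: "eventually (\<lambda>n. (a n - \<alpha>)\<^sup>2 + (m n - \<mu>)\<^sup>2 \<le> radius n) sequentially"
    using min sublevel_localized by eventually_elim blast
  have "(\<lambda>n. (a n - \<alpha>)\<^sup>2) \<longlonglongrightarrow> 0"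
    by (rule real_tendsto_sandwich[OF _ _ tendsto_const radius_tendsto])
       (use loc in \<open>auto elim!: eventually_mono intro: order_trans[rotated]\<close>)
  from tendsto_real_sqrt[OF this] have "a \<longlonglongrightarrow> \<alpha>"
    by (simp add: tendsto_rabs_zero_iff LIM_zero_iff)
  moreover have "(\<lambda>n. (m n - \<mu>)\<^sup>2) \<longlonglongrightarrow> 0"
    by (rule real_tendsto_sandwich[OF _ _ tendsto_const radius_tendsto])
       (use loc in \<open>auto elim!: eventually_mono intro: order_trans[rotated]\<close>)
  from tendsto_real_sqrt[OF this] have "m \<longlonglongrightarrow> \<mu>"
    by (simp add: tendsto_rabs_zero_iff LIM_zero_iff)
  moreover have "1 + \<alpha>\<^sup>2 \<noteq> 0" by (smt (verit) zero_le_power2)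
  ultimately have "(\<lambda>n. outlier_fit (a n) (m n)) \<longlonglongrightarrow> outlier_fit \<alpha> \<mu>"
    unfolding outlier_fit_def by (intro tendsto_intros) auto
  then have "t \<longlonglongrightarrow> outlier_fit \<alpha> \<mu>"
    by (rule Lim_transform_eventually) (rule fit)
  with \<open>a \<longlonglongrightarrow> \<alpha>\<close> \<open>m \<longlonglongrightarrow> \<mu>\<close>
  show "(\<lambda>n. fst (argminQ s n y)) \<longlonglongrightarrow> \<alpha>" "(\<lambda>n. fst (snd (argminQ s n y))) \<longlonglongrightarrow> \<mu>"
    "(\<lambda>n. snd (snd (argminQ s n y))) \<longlonglongrightarrow> outlier_fit \<alpha> \<mu>"
    unfolding a_def m_def t_def by auto
qed

end

section \<open>The INAR(1) process\<close>

text \<open>The joint law is a product, so Tonelli applies and both marginals are pulled back to M.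
  The inner sample point acts as an independent copy, which replaces conditioning on A.\<close>

lemma (in prob_space) indep_var_nn_integral_iterated:
  assumes ind: "indep_var S A T B" and f [measurable]: "f \<in> borel_measurable (S \<Otimes>\<^sub>M T)"
  shows "(\<integral>\<^sup>+ \<omega>. f (A \<omega>, B \<omega>) \<partial>M) = (\<integral>\<^sup>+ \<omega>. \<integral>\<^sup>+ \<omega>'. f (A \<omega>, B \<omega>') \<partial>M \<partial>M)"
proof -
  have [measurable]: "A \<in> measurable M S" "B \<in> measurable M T"
    using indep_var_rv1[OF ind] indep_var_rv2[OF ind] by auto
  interpret A: prob_space "distr M S A" by (rule prob_space_distr) simp
  interpret B: prob_space "distr M T B" by (rule prob_space_distr) simp
  have "(\<integral>\<^sup>+ \<omega>. f (A \<omega>, B \<omega>) \<partial>M) = integral\<^sup>N (distr M (S \<Otimes>\<^sub>M T) (\<lambda>\<omega>. (A \<omega>, B \<omega>))) f"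
    by (subst nn_integral_distr) auto
  also have "\<dots> = integral\<^sup>N (distr M S A \<Otimes>\<^sub>M distr M T B) f"
    using ind by (simp add: indep_var_distribution_eq)
  also have "\<dots> = (\<integral>\<^sup>+ x. \<integral>\<^sup>+ z. f (x, z) \<partial>distr M T B \<partial>distr M S A)"
    by (rule B.nn_integral_fst[symmetric]) simp
  also have "\<dots> = (\<integral>\<^sup>+ \<omega>. \<integral>\<^sup>+ z. f (A \<omega>, z) \<partial>distr M T B \<partial>M)"
    by (subst nn_integral_distr) auto
  also have "\<dots> = (\<integral>\<^sup>+ \<omega>. \<integral>\<^sup>+ \<omega>'. f (A \<omega>, B \<omega>') \<partial>M \<partial>M)"
    by (intro nn_integral_cong nn_integral_distr) (auto dest: measurable_space[rotated])
  finally show ?thesis .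
qed

lemma (in prob_space) indep_var_integral_iterated:
  fixes f :: "_ \<Rightarrow> real"
  assumes ind: "indep_var S A T B" and f [measurable]: "f \<in> borel_measurable (S \<Otimes>\<^sub>M T)"
    and int: "integrable M (\<lambda>\<omega>. f (A \<omega>, B \<omega>))"
  shows "(\<integral>\<omega>. f (A \<omega>, B \<omega>) \<partial>M) = (\<integral>\<omega>. \<integral>\<omega>'. f (A \<omega>, B \<omega>') \<partial>M \<partial>M)"
proof -
  have [measurable]: "A \<in> measurable M S" "B \<in> measurable M T"
    using indep_var_rv1[OF ind] indep_var_rv2[OF ind] by auto
  interpret A: prob_space "distr M S A" by (rule prob_space_distr) simp
  interpret B: prob_space "distr M T B" by (rule prob_space_distr) simp
  interpret AB: pair_prob_space "distr M S A" "distr M T B" ..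
  have eq: "distr M S A \<Otimes>\<^sub>M distr M T B = distr M (S \<Otimes>\<^sub>M T) (\<lambda>\<omega>. (A \<omega>, B \<omega>))"
    using ind by (simp add: indep_var_distribution_eq)
  have "(\<integral>\<omega>. f (A \<omega>, B \<omega>) \<partial>M) = integral\<^sup>L (distr M S A \<Otimes>\<^sub>M distr M T B) f"
    unfolding eq by (subst integral_distr) auto
  also have "\<dots> = (\<integral>x. \<integral>z. f (x, z) \<partial>distr M T B \<partial>distr M S A)"
    by (rule AB.integral_fst'[symmetric]) (use int in \<open>simp add: eq integrable_distr_eq\<close>)
  also have "\<dots> = (\<integral>\<omega>. \<integral>z. f (A \<omega>, z) \<partial>distr M T B \<partial>M)"
    by (subst integral_distr) (auto intro!: B.borel_measurable_lebesgue_integral)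
  also have "\<dots> = (\<integral>\<omega>. \<integral>\<omega>'. f (A \<omega>, B \<omega>') \<partial>M \<partial>M)"
    by (intro Bochner_Integration.integral_cong integral_distr) (auto dest: measurable_space[rotated])
  finally show ?thesis .
qed

lemma (in prob_space) indep_vars_sum_second_moment:
  fixes U :: "'i \<Rightarrow> 'a \<Rightarrow> real"
  assumes "finite I" and "indep_vars (\<lambda>_. borel) U I"
    and "\<And>i. i \<in> I \<Longrightarrow> integrable M (\<lambda>\<omega>. (U i \<omega>)\<^sup>2)" and "\<And>i. i \<in> I \<Longrightarrow> expectation (U i) = 0"
  shows "integrable M (\<lambda>\<omega>. (\<Sum>i\<in>I. U i \<omega>)\<^sup>2) \<and>
    expectation (\<lambda>\<omega>. (\<Sum>i\<in>I. U i \<omega>)\<^sup>2) = (\<Sum>i\<in>I. expectation (\<lambda>\<omega>. (U i \<omega>)\<^sup>2))"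
  using assms
proof (induction I rule: finite_induct)
  case (insert i I)
  have ind: "indep_var borel (U i) borel (\<lambda>\<omega>. \<Sum>i\<in>I. U i \<omega>)"
    using insert by (intro indep_vars_sum) auto
  have m [measurable]: "U j \<in> borel_measurable M" if "j \<in> insert i I" for j
    using insert.prems(1) that by (auto simp: indep_vars_def)
  have int: "integrable M (U j)" if "j \<in> insert i I" for j
    by (rule square_integrable_imp_integrable[OF m[OF that] insert.prems(2)[OF that]])
  have ints: "integrable M (\<lambda>\<omega>. \<Sum>i\<in>I. U i \<omega>)"
    using int by (intro Bochner_Integration.integrable_sum) auto
  have IH: "integrable M (\<lambda>\<omega>. (\<Sum>i\<in>I. U i \<omega>)\<^sup>2)"
    "expectation (\<lambda>\<omega>. (\<Sum>i\<in>I. U i \<omega>)\<^sup>2) = (\<Sum>i\<in>I. expectation (\<lambda>\<omega>. (U i \<omega>)\<^sup>2))"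
    using insert.IH insert.prems indep_vars_subset[of _ U "insert i I" I] by auto
  have cross: "integrable M (\<lambda>\<omega>. U i \<omega> * (\<Sum>i\<in>I. U i \<omega>))"
    "expectation (\<lambda>\<omega>. U i \<omega> * (\<Sum>i\<in>I. U i \<omega>)) = 0"
    using indep_var_integrable[OF ind int ints] indep_var_lebesgue_integral[OF ind int ints]
      insert.prems(3) by auto
  have eq: "(\<Sum>i\<in>insert i I. U i \<omega>)\<^sup>2
      = (U i \<omega>)\<^sup>2 + 2 * (U i \<omega> * (\<Sum>i\<in>I. U i \<omega>)) + (\<Sum>i\<in>I. U i \<omega>)\<^sup>2" for \<omega>
    using insert.hyps by (simp add: power2_sum algebra_simps)
  show ?case
    unfolding eq using IH cross insert.prems(2)[of i] insert.hyps by simp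
qed simp

section \<open>The model and its filtration\<close>

locale inar_process = prob_space M for M :: "'a measure" +
  fixes X0 :: "'a \<Rightarrow> nat" and eps :: "nat \<Rightarrow> 'a \<Rightarrow> nat" and xi :: "nat \<Rightarrow> nat \<Rightarrow> 'a \<Rightarrow> nat"
    and \<alpha> :: real
  assumes \<alpha>: "0 < \<alpha>" "\<alpha> < 1"
    and indep: "indep_vars (\<lambda>_. count_space UNIV) (inar_family X0 eps xi) inar_indices"
    and eps_ident: "\<And>k. k \<ge> 1 \<Longrightarrow> distr M (count_space UNIV) (eps k) = distr M (count_space UNIV) (eps 1)"
    and eps_sq: "integrable M (\<lambda>\<omega>. (real (eps 1 \<omega>))\<^sup>2)"
    and eps_nonzero: "measure M {\<omega> \<in> space M. eps 1 \<omega> \<noteq> 0} > 0"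
    and xi_bern: "\<And>k j. k \<ge> 1 \<Longrightarrow> j \<ge> 1 \<Longrightarrow>
        distr M (count_space UNIV) (xi k j) = measure_pmf (map_pmf (\<lambda>b. if b then 1 else 0) (bernoulli_pmf \<alpha>))"
    and X0_sq: "integrable M (\<lambda>\<omega>. (real (X0 \<omega>))\<^sup>2)"
begin

abbreviation primitive :: "inar_idx \<Rightarrow> 'a \<Rightarrow> nat" where
  "primitive \<equiv> inar_family X0 eps xi"

abbreviation X :: "nat \<Rightarrow> 'a \<Rightarrow> nat" where
  "X \<equiv> inarX X0 eps xi"

abbreviation \<mu> :: real where
  "\<mu> \<equiv> expectation (\<lambda>\<omega>. real (eps 1 \<omega>))"

text \<open>All counting variables of the generations up to k are included, since the number of them
  actually read is random and unbounded.\<close>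

definition past :: "nat \<Rightarrow> inar_idx set" where
  "past k = {IX0} \<union> {IEps i | i. 1 \<le> i \<and> i \<le> k} \<union> {IXi i j | i j. 1 \<le> i \<and> i \<le> k \<and> 1 \<le> j}"

definition fresh :: "nat \<Rightarrow> inar_idx set" where
  "fresh k = {IEps (Suc k)} \<union> {IXi (Suc k) j | j. 1 \<le> j}"

text \<open>\<open>indep_var\<close> relates two random variables with the same codomain type. Past and future are
  therefore both represented by the identity on the sample space, carrying different
  sigma-algebras.\<close>

definition generated :: "inar_idx set \<Rightarrow> 'a measure" where
  "generated J = vimage_algebra (space M) (\<lambda>\<omega>. \<lambda>i\<in>J. primitive i \<omega>) (PiM J (\<lambda>_. count_space UNIV))"

abbreviation history :: "nat \<Rightarrow> 'a measure" where
  "history k \<equiv> generated (past k)"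

text \<open>One transition from a deterministic state x: with the state frozen, conditional moments
  become ordinary moments of a finite sum of independent variables.\<close>

definition offspring :: "nat \<Rightarrow> nat \<Rightarrow> 'a \<Rightarrow> nat" where
  "offspring k x \<omega> = (\<Sum>j=1..x. xi (Suc k) j \<omega>) + eps (Suc k) \<omega>"

lemma X_Suc: "X (Suc k) \<omega> = offspring k (X k \<omega>) \<omega>"
  by (simp add: offspring_def)

lemma past_subset: "past k \<subseteq> inar_indices"
  by (auto simp: past_def inar_indices_def)

lemma fresh_subset: "fresh k \<subseteq> inar_indices"
  by (auto simp: fresh_def inar_indices_def)

lemma past_fresh_disjoint: "past k \<inter> fresh k = {}"
  by (auto simp: past_def fresh_def)

lemma primitive_measurable: "i \<in> inar_indices \<Longrightarrow> primitive i \<in> measurable M (count_space UNIV)"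
  using indep by (auto simp: indep_vars_def)

lemma primitive_restrict_measurable:
  "J \<subseteq> inar_indices \<Longrightarrow>
    (\<lambda>\<omega>. \<lambda>i\<in>J. primitive i \<omega>) \<in> measurable M (PiM J (\<lambda>_. count_space UNIV))"
  by (intro measurable_restrict primitive_measurable) auto

lemma space_generated: "space (generated J) = space M"
  by (simp add: generated_def)

lemma primitive_generated:
  assumes "i \<in> J"
  shows "primitive i \<in> measurable (generated J) (count_space UNIV)"
proof -
  have "(\<lambda>\<omega>. \<lambda>i\<in>J. primitive i \<omega>) \<in> measurable (generated J) (PiM J (\<lambda>_. count_space UNIV))"
    unfolding generated_def by (intro measurable_vimage_algebra1) (auto simp: space_PiM)
  from measurable_compose[OF this measurable_component_singleton[OF assms]] show ?thesis
    using assms by simp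
qed

lemma sets_generated_subset:
  assumes "J \<subseteq> inar_indices"
  shows "sets (generated J) \<subseteq> sets M"
  unfolding generated_def sets_vimage_algebra
  by (rule sets.sigma_sets_subset) (use measurable_sets[OF primitive_restrict_measurable[OF assms]] in blast)

lemma generated_mono:
  assumes "J \<subseteq> K"
  shows "sets (generated J) \<subseteq> sets (generated K)"
proof -
  have "(\<lambda>\<omega>. \<lambda>i\<in>J. primitive i \<omega>) \<in> measurable (generated K) (PiM J (\<lambda>_. count_space UNIV))"
    using assms by (intro measurable_restrict primitive_generated) auto
  from measurable_sets[OF this] have "sigma_sets (space (generated K))
      {(\<lambda>\<omega>. \<lambda>i\<in>J. primitive i \<omega>) -` A \<inter> space (generated K) | A. A \<in> sets (PiM J (\<lambda>_. count_space UNIV))}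
    \<subseteq> sets (generated K)"
    by (intro sets.sigma_sets_subset) blast
  then show ?thesis by (simp add: generated_def[of J] sets_vimage_algebra space_generated)
qed

lemma generated_measurable:
  "J \<subseteq> inar_indices \<Longrightarrow> f \<in> measurable (generated J) N \<Longrightarrow> f \<in> measurable M N"
  using sets_generated_subset[of J] by (auto simp: measurable_def space_generated)

lemma generated_mono_measurable:
  "J \<subseteq> K \<Longrightarrow> f \<in> measurable (generated J) N \<Longrightarrow> f \<in> measurable (generated K) N"
  using generated_mono[of J K] by (auto simp: measurable_def space_generated)

lemma past_mono: "past k \<subseteq> past (Suc k)"
  by (auto simp: past_def)

lemma fresh_subset_past: "fresh k \<subseteq> past (Suc k)"
  by (auto simp: past_def fresh_def)

lemma offspring_fresh: "offspring k x \<in> measurable (generated (fresh k)) (count_space UNIV)"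
proof -
  have x: "xi (Suc k) j \<in> measurable (generated (fresh k)) (count_space UNIV)" if "1 \<le> j" for j
    using primitive_generated[of "IXi (Suc k) j" "fresh k"] that by (simp add: fresh_def inar_family_def)
  have [measurable]: "eps (Suc k) \<in> measurable (generated (fresh k)) (count_space UNIV)"
    using primitive_generated[of "IEps (Suc k)" "fresh k"] by (simp add: fresh_def inar_family_def)
  have "(\<lambda>\<omega>. \<Sum>j=1..n. xi (Suc k) j \<omega>) \<in> measurable (generated (fresh k)) (count_space UNIV)" for n
  proof (induction n)
    case (Suc n)
    have [measurable]: "xi (Suc k) (Suc n) \<in> measurable (generated (fresh k)) (count_space UNIV)"
      by (rule x) simp
    note [measurable] = Suc
    have "(\<lambda>\<omega>. (\<Sum>j=1..n. xi (Suc k) j \<omega>) + xi (Suc k) (Suc n) \<omega>)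
        \<in> measurable (generated (fresh k)) (count_space UNIV)"
      by measurable
    then show ?case by simp
  qed simp
  note [measurable] = this
  show ?thesis unfolding offspring_def[abs_def] by measurable
qed

lemma offspring_measurable [measurable]: "offspring k x \<in> measurable M (count_space UNIV)"
  by (rule generated_measurable[OF fresh_subset offspring_fresh])

lemma X_history: "X k \<in> measurable (history k) (count_space UNIV)"
proof (induction k)
  case 0
  have "X 0 = primitive IX0" by (auto simp: inar_family_def)
  then show ?case using primitive_generated[of IX0 "past 0"] by (simp add: past_def)
next
  case (Suc k)
  have "offspring k n \<in> measurable (history (Suc k)) (count_space UNIV)" for n
    by (rule generated_mono_measurable[OF fresh_subset_past offspring_fresh])
  then have "(\<lambda>\<omega>. offspring k (X k \<omega>) \<omega>) \<in> measurable (history (Suc k)) (count_space UNIV)"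
    by (rule measurable_compose_countable) (rule generated_mono_measurable[OF past_mono Suc])
  moreover have "X (Suc k) = (\<lambda>\<omega>. offspring k (X k \<omega>) \<omega>)" by (rule ext) (rule X_Suc)
  ultimately show ?case by simp
qed

lemma X_measurable [measurable]: "X k \<in> measurable M (count_space UNIV)"
  by (rule generated_measurable[OF past_subset X_history])

text \<open>Preimages under the identity, the form in which \<open>indep_var_eq\<close> presents a
  sigma-algebra, reproduce the sigma-algebra itself.\<close>

lemma sigma_sets_generated:
  "sigma_sets (space M) {(\<lambda>\<omega>. \<omega>) -` A \<inter> space M | A. A \<in> sets (generated J)} = sets (generated J)"
proof -
  have "{(\<lambda>\<omega>. \<omega>) -` A \<inter> space M | A. A \<in> sets (generated J)} = (\<lambda>A. A \<inter> space M) ` sets (generated J)"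
    by auto
  also have "\<dots> = (\<lambda>A. A) ` sets (generated J)"
    using sets.sets_into_space[of _ "generated J"]
    by (intro image_cong refl) (metis Int_absorb2 space_generated)
  finally show ?thesis
    using sets.sigma_sets_eq[of "generated J"] by (simp add: space_generated)
qed

text \<open>Disjoint blocks of an independent family are independent, and the preimages of the two
  restriction maps are exactly the two generated sigma-algebras.\<close>

lemma history_indep_fresh:
  "indep_var (history k) (\<lambda>\<omega>. \<omega>) (generated (fresh k)) (\<lambda>\<omega>. \<omega>)"
proof -
  have ind: "indep_var (PiM (past k) (\<lambda>_. count_space UNIV)) (\<lambda>\<omega>. \<lambda>i\<in>past k. primitive i \<omega>)
     (PiM (fresh k) (\<lambda>_. count_space UNIV)) (\<lambda>\<omega>. \<lambda>i\<in>fresh k. primitive i \<omega>)"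
    by (rule indep_var_restrict[OF indep past_fresh_disjoint past_subset fresh_subset])
  have eq: "sigma_sets (space M) {(\<lambda>\<omega>. \<lambda>i\<in>J. primitive i \<omega>) -` A \<inter> space M | A.
      A \<in> sets (PiM J (\<lambda>_. count_space UNIV))} = sets (generated J)" for J
    by (simp add: generated_def sets_vimage_algebra)
  have id: "(\<lambda>\<omega>. \<omega>) \<in> measurable M (generated J)" if "J \<subseteq> inar_indices" for J
    by (rule generated_measurable[OF that]) (rule measurable_ident_sets[OF refl])
  show ?thesis
    using ind id[OF past_subset] id[OF fresh_subset]
    unfolding indep_var_eq sigma_sets_generated eq by blast
qed

text \<open>States are natural numbers, so joint measurability is checked separately for each value
  of the present and of the next state.\<close>

lemma history_step_measurable:
  assumes Z: "Z \<in> measurable (history k) N" and h: "\<And>a b. h a b \<in> measurable N N'"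
  shows "(\<lambda>p. h (X k (fst p)) (offspring k (X k (fst p)) (snd p)) (Z (fst p)))
    \<in> measurable (history k \<Otimes>\<^sub>M generated (fresh k)) N'"
proof -
  let ?P = "history k \<Otimes>\<^sub>M generated (fresh k)"
  have 1: "(\<lambda>p. X k (fst p)) \<in> measurable ?P (count_space UNIV)"
    by (rule measurable_compose[OF measurable_fst X_history])
  have 2: "(\<lambda>p. offspring k x (snd p)) \<in> measurable ?P (count_space UNIV)" for x
    by (rule measurable_compose[OF measurable_snd offspring_fresh])
  have 3: "(\<lambda>p. h a b (Z (fst p))) \<in> measurable ?P N'" for a b
    by (rule measurable_compose[OF measurable_compose[OF measurable_fst Z] h])
  have "(\<lambda>p. h x (offspring k x (snd p)) (Z (fst p))) \<in> measurable ?P N'" for x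
    by (rule measurable_compose_countable[OF _ 2]) (rule 3)
  then show ?thesis by (rule measurable_compose_countable[OF _ 1])
qed

text \<open>The Markov property in integrated form: the state comes from \<omega>, the transition
  from an independent copy \<omega>'.\<close>

lemma nn_integral_history_step:
  fixes h :: "nat \<Rightarrow> nat \<Rightarrow> ennreal"
  shows "(\<integral>\<^sup>+ \<omega>. h (X k \<omega>) (X (Suc k) \<omega>) \<partial>M)
    = (\<integral>\<^sup>+ \<omega>. \<integral>\<^sup>+ \<omega>'. h (X k \<omega>) (offspring k (X k \<omega>) \<omega>') \<partial>M \<partial>M)"
  using indep_var_nn_integral_iterated[OF history_indep_fresh
    history_step_measurable[where Z="\<lambda>\<omega>. \<omega>" and N="history k" and h="\<lambda>a b _. h a b" and N'=borel and k=k]]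
  by (simp add: X_Suc del: inarX.simps)

lemma integral_history_step:
  fixes h :: "nat \<Rightarrow> nat \<Rightarrow> real"
  assumes Z: "Z \<in> borel_measurable (history k)"
    and int: "integrable M (\<lambda>\<omega>. Z \<omega> * h (X k \<omega>) (X (Suc k) \<omega>))"
  shows "expectation (\<lambda>\<omega>. Z \<omega> * h (X k \<omega>) (X (Suc k) \<omega>))
    = expectation (\<lambda>\<omega>. Z \<omega> * expectation (\<lambda>\<omega>'. h (X k \<omega>) (offspring k (X k \<omega>) \<omega>')))"
  using indep_var_integral_iterated[OF history_indep_fresh
    history_step_measurable[OF Z, where h="\<lambda>a b z. z * h a b" and N'=borel]] int
  by (simp add: X_Suc del: inarX.simps)

end

section \<open>Moments and point probabilities of one transition\<close>

context inar_process
begin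

lemma eps_measurable: "eps (Suc k) \<in> measurable M (count_space UNIV)"
  using primitive_measurable[of "IEps (Suc k)"] by (simp add: inar_indices_def inar_family_def)

lemma xi_measurable: "1 \<le> j \<Longrightarrow> xi (Suc k) j \<in> measurable M (count_space UNIV)"
  using primitive_measurable[of "IXi (Suc k) j"] by (simp add: inar_indices_def inar_family_def)

lemma eps_expectation:
  fixes g :: "nat \<Rightarrow> real"
  shows "expectation (\<lambda>\<omega>. g (eps (Suc k) \<omega>)) = expectation (\<lambda>\<omega>. g (eps 1 \<omega>))"
    and "integrable M (\<lambda>\<omega>. g (eps (Suc k) \<omega>)) \<longleftrightarrow> integrable M (\<lambda>\<omega>. g (eps 1 \<omega>))"
proof -
  have [measurable]: "eps 1 \<in> measurable M (count_space UNIV)" using eps_measurable[of 0] by simp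
  note [measurable] = eps_measurable[of k] eps_measurable[of 0]
  have eq: "distr M (count_space UNIV) (eps (Suc k)) = distr M (count_space UNIV) (eps 1)"
    by (rule eps_ident) simp
  show "expectation (\<lambda>\<omega>. g (eps (Suc k) \<omega>)) = expectation (\<lambda>\<omega>. g (eps 1 \<omega>))"
    using arg_cong[OF eq, of "\<lambda>N. integral\<^sup>L N g"] by (simp add: integral_distr)
  show "integrable M (\<lambda>\<omega>. g (eps (Suc k) \<omega>)) \<longleftrightarrow> integrable M (\<lambda>\<omega>. g (eps 1 \<omega>))"
    using arg_cong[OF eq, of "\<lambda>N. integrable N g"] by (simp add: integrable_distr_eq)
qed

lemma xi_expectation:
  fixes g :: "nat \<Rightarrow> real"
  assumes "1 \<le> j"
  shows "expectation (\<lambda>\<omega>. g (xi (Suc k) j \<omega>)) = \<alpha> * g 1 + (1 - \<alpha>) * g 0"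
    and "integrable M (\<lambda>\<omega>. g (xi (Suc k) j \<omega>))"
proof -
  note [measurable] = xi_measurable[OF assms]
  have eq: "distr M (count_space UNIV) (xi (Suc k) j)
      = measure_pmf (map_pmf (\<lambda>b. if b then 1 else 0) (bernoulli_pmf \<alpha>))"
    by (rule xi_bern) (use assms in auto)
  have "expectation (\<lambda>\<omega>. g (xi (Suc k) j \<omega>)) = integral\<^sup>L (distr M (count_space UNIV) (xi (Suc k) j)) g"
    by (simp add: integral_distr)
  also have "\<dots> = \<alpha> * g 1 + (1 - \<alpha>) * g 0"
    unfolding eq using \<alpha> by simp
  finally show "expectation (\<lambda>\<omega>. g (xi (Suc k) j \<omega>)) = \<alpha> * g 1 + (1 - \<alpha>) * g 0" .
  have "integrable (distr M (count_space UNIV) (xi (Suc k) j)) g"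
    unfolding eq by (rule integrable_measure_pmf_finite) simp
  then show "integrable M (\<lambda>\<omega>. g (xi (Suc k) j \<omega>))"
    by (simp add: integrable_distr_eq)
qed

lemma eps_integrable: "integrable M (\<lambda>\<omega>. real (eps 1 \<omega>))"
proof -
  have [measurable]: "eps 1 \<in> measurable M (count_space UNIV)" using eps_measurable[of 0] by simp
  show ?thesis by (rule square_integrable_imp_integrable[OF _ eps_sq]) measurable
qed

definition eps_var :: real where
  "eps_var = expectation (\<lambda>\<omega>. (real (eps 1 \<omega>) - \<mu>)\<^sup>2)"

lemma eps_var_nonneg: "0 \<le> eps_var"
  by (simp add: eps_var_def)

definition offspring_idx :: "nat \<Rightarrow> nat \<Rightarrow> inar_idx set" where
  "offspring_idx k x = insert (IEps (Suc k)) (IXi (Suc k) ` {1..x})"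

lemma finite_offspring_idx: "finite (offspring_idx k x)"
  by (simp add: offspring_idx_def)

lemma offspring_idx_subset: "offspring_idx k x \<subseteq> inar_indices"
  by (auto simp: offspring_idx_def inar_indices_def)

lemma sum_offspring_idx:
  "sum f (offspring_idx k x) = f (IEps (Suc k)) + (\<Sum>j=1..x. f (IXi (Suc k) j) :: real)"
  by (simp add: offspring_idx_def sum.reindex inj_on_def image_iff)

lemma prod_offspring_idx:
  "prod f (offspring_idx k x) = f (IEps (Suc k)) * (\<Prod>j=1..x. f (IXi (Suc k) j) :: real)"
  by (simp add: offspring_idx_def prod.reindex inj_on_def image_iff)

definition centred :: "inar_idx \<Rightarrow> 'a \<Rightarrow> real" where
  "centred i \<omega> = real (primitive i \<omega>) - (case i of IEps _ \<Rightarrow> \<mu> | _ \<Rightarrow> \<alpha>)"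

lemma offspring_centred: "real (offspring k x \<omega>) - \<alpha> * x - \<mu> = (\<Sum>i\<in>offspring_idx k x. centred i \<omega>)"
  by (simp add: sum_offspring_idx centred_def inar_family_def offspring_def sum_subtractf)

lemma centred_indep: "indep_vars (\<lambda>_. borel) centred (offspring_idx k x)"
proof -
  have "indep_vars (\<lambda>_. borel) (\<lambda>i \<omega>. (\<lambda>n. real n - (case i of IEps _ \<Rightarrow> \<mu> | _ \<Rightarrow> \<alpha>)) (primitive i \<omega>))
      (offspring_idx k x)"
    by (rule indep_vars_compose2[OF indep_vars_subset[OF indep offspring_idx_subset]]) simp
  then show ?thesis by (simp add: centred_def[abs_def])
qed

lemma centred_moments:
  assumes "i \<in> offspring_idx k x"
  shows "expectation (centred i) = 0" "integrable M (\<lambda>\<omega>. (centred i \<omega>)\<^sup>2)" "integrable M (centred i)"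
    "expectation (\<lambda>\<omega>. (centred i \<omega>)\<^sup>2) = (case i of IEps _ \<Rightarrow> eps_var | _ \<Rightarrow> \<alpha> * (1 - \<alpha>))"
proof -
  have sq: "integrable M (\<lambda>\<omega>. (real (eps 1 \<omega>) - \<mu>)\<^sup>2)"
    unfolding power2_diff using eps_sq eps_integrable by simp
  consider "i = IEps (Suc k)" | j where "i = IXi (Suc k) j" "1 \<le> j"
    using assms by (auto simp: offspring_idx_def)
  then have "expectation (centred i) = 0 \<and> integrable M (\<lambda>\<omega>. (centred i \<omega>)\<^sup>2) \<and> integrable M (centred i)
    \<and> expectation (\<lambda>\<omega>. (centred i \<omega>)\<^sup>2) = (case i of IEps _ \<Rightarrow> eps_var | _ \<Rightarrow> \<alpha> * (1 - \<alpha>))"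
  proof cases
    case 1
    then have c: "centred i = (\<lambda>\<omega>. real (eps (Suc k) \<omega>) - \<mu>)"
      by (auto simp: centred_def inar_family_def)
    show ?thesis
      using eps_expectation[of "\<lambda>n. real n - \<mu>" k] eps_expectation[of "\<lambda>n. (real n - \<mu>)\<^sup>2" k] sq eps_integrable 1
      unfolding c by (simp add: prob_space eps_var_def)
  next
    case 2
    then have c: "centred i = (\<lambda>\<omega>. real (xi (Suc k) j \<omega>) - \<alpha>)"
      by (auto simp: centred_def inar_family_def)
    show ?thesis
      using xi_expectation[OF 2(2), of "\<lambda>n. real n - \<alpha>" k] xi_expectation[OF 2(2), of "\<lambda>n. (real n - \<alpha>)\<^sup>2" k] 2(1)
      unfolding c by (simp add: power2_eq_square algebra_simps)
  qed
  then show "expectation (centred i) = 0" "integrable M (\<lambda>\<omega>. (centred i \<omega>)\<^sup>2)" "integrable M (centred i)"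
    "expectation (\<lambda>\<omega>. (centred i \<omega>)\<^sup>2) = (case i of IEps _ \<Rightarrow> eps_var | _ \<Rightarrow> \<alpha> * (1 - \<alpha>))"
    by auto
qed

lemma centred_sum_second_moment:
  "integrable M (\<lambda>\<omega>. (\<Sum>i\<in>offspring_idx k x. centred i \<omega>)\<^sup>2) \<and>
   expectation (\<lambda>\<omega>. (\<Sum>i\<in>offspring_idx k x. centred i \<omega>)\<^sup>2)
     = (\<Sum>i\<in>offspring_idx k x. expectation (\<lambda>\<omega>. (centred i \<omega>)\<^sup>2))"
  by (rule indep_vars_sum_second_moment[OF finite_offspring_idx centred_indep]) (auto intro: centred_moments)

lemma offspring_mean: "expectation (\<lambda>\<omega>. real (offspring k x \<omega>) - \<alpha> * x - \<mu>) = 0"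
  unfolding offspring_centred
  by (subst Bochner_Integration.integral_sum) (auto intro: centred_moments sum.neutral)

lemma offspring_square_integrable: "integrable M (\<lambda>\<omega>. (real (offspring k x \<omega>) - \<alpha> * x - \<mu>)\<^sup>2)"
  unfolding offspring_centred
  using centred_sum_second_moment by blast

lemma offspring_integrable: "integrable M (\<lambda>\<omega>. real (offspring k x \<omega>) - \<alpha> * x - \<mu>)"
  by (rule square_integrable_imp_integrable[OF _ offspring_square_integrable]) measurable

text \<open>Variances add by independence, giving x * \<alpha> * (1 - \<alpha>) +
  \<open>eps_var\<close>. Only linear growth in x matters later, so the factor \<alpha> * (1 -
  \<alpha>) is replaced by 1.\<close>

lemma offspring_variance:
  "expectation (\<lambda>\<omega>. (real (offspring k x \<omega>) - \<alpha> * x - \<mu>)\<^sup>2) \<le> x + eps_var"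
proof -
  have "expectation (\<lambda>\<omega>. (real (offspring k x \<omega>) - \<alpha> * x - \<mu>)\<^sup>2)
      = (\<Sum>i\<in>offspring_idx k x. expectation (\<lambda>\<omega>. (centred i \<omega>)\<^sup>2))"
    unfolding offspring_centred
    using centred_sum_second_moment by blast
  also have "\<dots> = (\<Sum>i\<in>offspring_idx k x. (case i of IEps _ \<Rightarrow> eps_var | _ \<Rightarrow> \<alpha> * (1 - \<alpha>)))"
    by (rule sum.cong) (auto simp: centred_moments)
  also have "\<dots> = x * (\<alpha> * (1 - \<alpha>)) + eps_var"
    by (simp add: sum_offspring_idx)
  also have "x * (\<alpha> * (1 - \<alpha>)) \<le> real x * 1"
    using \<alpha> mult_le_one[of \<alpha> "1 - \<alpha>"] by (intro mult_left_mono) auto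
  finally show ?thesis by simp
qed

lemma offspring_second_moment:
  "integrable M (\<lambda>\<omega>. (real (offspring k x \<omega>))\<^sup>2)"
  "expectation (\<lambda>\<omega>. (real (offspring k x \<omega>))\<^sup>2) \<le> (\<alpha> * x + \<mu>)\<^sup>2 + x + eps_var"
proof -
  define m where "m = \<alpha> * x + \<mu>"
  define V where "V = (\<lambda>\<omega>. real (offspring k x \<omega>) - \<alpha> * x - \<mu>)"
  have eq: "(real (offspring k x \<omega>))\<^sup>2 = (V \<omega>)\<^sup>2 + 2 * m * V \<omega> + m\<^sup>2" for \<omega>
    by (simp add: V_def m_def power2_eq_square algebra_simps)
  have V: "integrable M (\<lambda>\<omega>. (V \<omega>)\<^sup>2)" "integrable M V" "expectation V = 0"
    "expectation (\<lambda>\<omega>. (V \<omega>)\<^sup>2) \<le> x + eps_var"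
    using offspring_square_integrable[of k x] offspring_integrable[of k x] offspring_mean[of k x] offspring_variance[of k x]
    unfolding V_def by auto
  show "integrable M (\<lambda>\<omega>. (real (offspring k x \<omega>))\<^sup>2)"
    unfolding eq using V by simp
  show "expectation (\<lambda>\<omega>. (real (offspring k x \<omega>))\<^sup>2) \<le> (\<alpha> * x + \<mu>)\<^sup>2 + x + eps_var"
    unfolding eq using V by (simp add: prob_space m_def)
qed

text \<open>Prescribing every Bernoulli outcome and the innovation is a subevent whose probability
  factorizes, each Bernoulli factor being at least min \<alpha> (1 - \<alpha>). With b = 0 it leads
  from any state to e; with a single 1 it leads from e to e + 1.\<close>

lemma offspring_prob_ge:
  assumes b: "\<And>j. b j \<le> (1::nat)"
  shows "prob {\<omega> \<in> space M. eps 1 \<omega> = e} * (min \<alpha> (1 - \<alpha>)) ^ x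
    \<le> prob {\<omega> \<in> space M. offspring k x \<omega> = (\<Sum>j=1..x. b j) + e}"
proof -
  define A where "A = (\<lambda>i. case i of IXi _ j \<Rightarrow> {b j} | _ \<Rightarrow> {e})"
  have prob_g: "prob {\<omega> \<in> space M. f \<omega> = c} = expectation (\<lambda>\<omega>. of_bool (f \<omega> = c))"
    if [measurable]: "f \<in> measurable M (count_space UNIV)" for f :: "'a \<Rightarrow> nat" and c
  proof -
    have "prob {\<omega> \<in> space M. f \<omega> = c} = expectation (indicator {\<omega> \<in> space M. f \<omega> = c})" by simp
    also have "\<dots> = expectation (\<lambda>\<omega>. of_bool (f \<omega> = c))"
      by (rule Bochner_Integration.integral_cong) (auto simp: indicator_def)
    finally show ?thesis .
  qed
  have e1 [measurable]: "eps 1 \<in> measurable M (count_space UNIV)" using eps_measurable[of 0] by simp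
  have pe: "prob (primitive (IEps (Suc k)) -` A (IEps (Suc k)) \<inter> space M) = prob {\<omega> \<in> space M. eps 1 \<omega> = e}"
  proof -
    have "primitive (IEps (Suc k)) -` A (IEps (Suc k)) \<inter> space M = {\<omega> \<in> space M. eps (Suc k) \<omega> = e}"
      by (auto simp: A_def inar_family_def)
    then show ?thesis
      using prob_g[OF eps_measurable] prob_g[OF e1] eps_expectation(1)[of "\<lambda>n. of_bool (n = e)" k] by simp
  qed
  have px: "min \<alpha> (1 - \<alpha>) \<le> prob (primitive (IXi (Suc k) j) -` A (IXi (Suc k) j) \<inter> space M)" if "1 \<le> j" for j
  proof -
    have "primitive (IXi (Suc k) j) -` A (IXi (Suc k) j) \<inter> space M = {\<omega> \<in> space M. xi (Suc k) j \<omega> = b j}"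
      by (auto simp: A_def inar_family_def)
    then have "prob (primitive (IXi (Suc k) j) -` A (IXi (Suc k) j) \<inter> space M)
        = \<alpha> * of_bool (1 = b j) + (1 - \<alpha>) * of_bool (0 = b j)"
      using prob_g[OF xi_measurable[OF that]] xi_expectation(1)[OF that, of "\<lambda>n. of_bool (n = b j)" k] by simp
    moreover have "b j = 0 \<or> b j = 1" using b[of j] by linarith
    ultimately show ?thesis by auto
  qed
  have "prob {\<omega> \<in> space M. eps 1 \<omega> = e} * (min \<alpha> (1 - \<alpha>)) ^ x
      = prob {\<omega> \<in> space M. eps 1 \<omega> = e} * (\<Prod>j=1..x. min \<alpha> (1 - \<alpha>))"
    by simp
  also have "\<dots> \<le> (\<Prod>i\<in>offspring_idx k x. prob (primitive i -` A i \<inter> space M))"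
    unfolding prod_offspring_idx pe using \<alpha> px by (intro mult_left_mono prod_mono) auto
  also have "\<dots> = prob (\<Inter>i\<in>offspring_idx k x. primitive i -` A i \<inter> space M)"
    by (rule indep_varsD[OF indep, symmetric])
      (auto simp: offspring_idx_subset finite_offspring_idx, simp add: offspring_idx_def)
  also have "\<dots> \<le> prob {\<omega> \<in> space M. offspring k x \<omega> = (\<Sum>j=1..x. b j) + e}"
  proof (rule finite_measure_mono)
    show "(\<Inter>i\<in>offspring_idx k x. primitive i -` A i \<inter> space M)
        \<subseteq> {\<omega> \<in> space M. offspring k x \<omega> = (\<Sum>j=1..x. b j) + e}"
      by (auto simp: offspring_idx_def A_def inar_family_def offspring_def intro!: sum.cong)
  qed measurable
  finally show ?thesis .
qed

text \<open>Here w dominates the conditional second moment. Working with the nonnegative integral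
  first lets integrability come out of the bound.\<close>

lemma history_step_second_moment:
  assumes "integrable M (\<lambda>\<omega>. w (X k \<omega>))" "\<And>x. 0 \<le> w x"
    and "\<And>x. integrable M (\<lambda>\<omega>. (h x (offspring k x \<omega>))\<^sup>2)"
    and "\<And>x. expectation (\<lambda>\<omega>. (h x (offspring k x \<omega>))\<^sup>2) \<le> (w x :: real)"
  shows "integrable M (\<lambda>\<omega>. (h (X k \<omega>) (X (Suc k) \<omega>) :: real)\<^sup>2)"
    "expectation (\<lambda>\<omega>. (h (X k \<omega>) (X (Suc k) \<omega>))\<^sup>2) \<le> expectation (\<lambda>\<omega>. w (X k \<omega>))"
proof -
  have m: "(\<lambda>\<omega>. (h (X k \<omega>) (X (Suc k) \<omega>))\<^sup>2) \<in> borel_measurable M"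
    by (rule measurable_compose_countable[OF _ X_measurable[of k]],
        rule measurable_compose_countable[OF _ X_measurable[of "Suc k"]]) simp
  have "(\<integral>\<^sup>+ \<omega>. ennreal ((h (X k \<omega>) (X (Suc k) \<omega>))\<^sup>2) \<partial>M)
      = (\<integral>\<^sup>+ \<omega>. \<integral>\<^sup>+ \<omega>'. ennreal ((h (X k \<omega>) (offspring k (X k \<omega>) \<omega>'))\<^sup>2) \<partial>M \<partial>M)"
    by (rule nn_integral_history_step)
  also have "\<dots> \<le> (\<integral>\<^sup>+ \<omega>. ennreal (w (X k \<omega>)) \<partial>M)"
  proof (rule nn_integral_mono)
    fix \<omega>
    have "(\<integral>\<^sup>+ \<omega>'. ennreal ((h (X k \<omega>) (offspring k (X k \<omega>) \<omega>'))\<^sup>2) \<partial>M)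
        = ennreal (expectation (\<lambda>\<omega>'. (h (X k \<omega>) (offspring k (X k \<omega>) \<omega>'))\<^sup>2))"
      by (rule nn_integral_eq_integral) (use assms in auto)
    then show "(\<integral>\<^sup>+ \<omega>'. ennreal ((h (X k \<omega>) (offspring k (X k \<omega>) \<omega>'))\<^sup>2) \<partial>M) \<le> ennreal (w (X k \<omega>))"
      using assms by (simp add: ennreal_leI)
  qed
  also have "\<dots> = ennreal (expectation (\<lambda>\<omega>. w (X k \<omega>)))"
    by (rule nn_integral_eq_integral) (use assms in auto)
  finally have le: "(\<integral>\<^sup>+ \<omega>. ennreal ((h (X k \<omega>) (X (Suc k) \<omega>))\<^sup>2) \<partial>M) \<le> ennreal (expectation (\<lambda>\<omega>. w (X k \<omega>)))" .
  show int: "integrable M (\<lambda>\<omega>. (h (X k \<omega>) (X (Suc k) \<omega>))\<^sup>2)"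
    by (rule integrableI_nonneg[OF m]) (use le in \<open>auto simp: top_unique intro: le_less_trans\<close>)
  show "expectation (\<lambda>\<omega>. (h (X k \<omega>) (X (Suc k) \<omega>))\<^sup>2) \<le> expectation (\<lambda>\<omega>. w (X k \<omega>))"
    using le assms(2) by (subst (asm) nn_integral_eq_integral[OF int]) (auto simp: ennreal_le_iff)
qed

text \<open>A transition multiplies the second moment by at most \<beta> < 1 and adds a constant, so
  any level above the fixed point C / (1 - \<beta>) is preserved.\<close>

lemma X_second_moment_bounded:
  obtains B where "0 \<le> B" "\<And>k. integrable M (\<lambda>\<omega>. (real (X k \<omega>))\<^sup>2)"
    "\<And>k. expectation (\<lambda>\<omega>. (real (X k \<omega>))\<^sup>2) \<le> B"
proof -
  \<comment> \<open>The midpoint between \<alpha>^2 and 1: the slack \<open>d\<close> above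
    \<alpha>^2 absorbs the linear term b * x at the price b^2 / (4 * d).\<close>
  define \<beta> where "\<beta> = (1 + \<alpha>\<^sup>2) / 2"
  define b where "b = 2 * \<alpha> * \<mu> + 1"
  define d where "d = \<beta> - \<alpha>\<^sup>2"
  define C where "C = b\<^sup>2 / (4 * d) + \<mu>\<^sup>2 + eps_var"
  have a2: "\<alpha>\<^sup>2 < 1" using \<alpha> by (simp add: abs_square_less_1)
  have d: "0 < d" and \<beta>: "0 \<le> \<beta>" "\<beta> < 1" using a2 by (auto simp: d_def \<beta>_def field_simps)
  have C: "0 \<le> C" using d eps_var_nonneg by (simp add: C_def)
  have contraction: "(\<alpha> * x + \<mu>)\<^sup>2 + x + eps_var \<le> \<beta> * x\<^sup>2 + C" for x :: real
  proof -
    have "0 \<le> (2 * d * x - b)\<^sup>2 / (4 * d)" using d by simp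
    also have "\<dots> = d * x\<^sup>2 - b * x + b\<^sup>2 / (4 * d)"
      using d by (simp add: field_simps power2_eq_square)
    finally show ?thesis by (simp add: C_def b_def d_def power2_eq_square algebra_simps)
  qed
  define B where "B = max (expectation (\<lambda>\<omega>. (real (X0 \<omega>))\<^sup>2)) (C / (1 - \<beta>))"
  have "integrable M (\<lambda>\<omega>. (real (X k \<omega>))\<^sup>2) \<and> expectation (\<lambda>\<omega>. (real (X k \<omega>))\<^sup>2) \<le> B" for k
  proof (induction k)
    case 0
    then show ?case using X0_sq by (simp add: B_def)
  next
    case (Suc k)
    have int: "integrable M (\<lambda>\<omega>. \<beta> * (real (X k \<omega>))\<^sup>2 + C)" using Suc by simp
    have bnd: "expectation (\<lambda>\<omega>. (real (offspring k x \<omega>))\<^sup>2) \<le> \<beta> * (real x)\<^sup>2 + C" for x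
      using offspring_second_moment(2)[of k x] contraction[of "real x"] by linarith
    note step = history_step_second_moment[where h="\<lambda>_ v. real v" and w="\<lambda>x. \<beta> * (real x)\<^sup>2 + C" and k=k,
        OF int _ offspring_second_moment(1) bnd]
    have "expectation (\<lambda>\<omega>. \<beta> * (real (X k \<omega>))\<^sup>2 + C) \<le> \<beta> * B + C"
      using Suc \<beta> by (simp add: prob_space mult_left_mono)
    also have "\<dots> \<le> B"
    proof -
      have "C / (1 - \<beta>) \<le> B" by (simp add: B_def)
      then have "C \<le> B * (1 - \<beta>)" using \<beta> by (simp add: pos_divide_le_eq)
      then show ?thesis by (simp add: algebra_simps)
    qed
    finally show ?case using step \<beta> C by (simp del: inarX.simps)
  qed
  moreover have "0 \<le> B" by (simp add: B_def le_max_iff_disj)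
  ultimately show ?thesis using that by blast
qed

end

section \<open>Strong consistency\<close>

text \<open>Finitely many altered terms shift the sums by a fixed amount. This serves to undo a
  truncation and to omit the two outlier indices.\<close>

lemma average_tendsto_eventually_cong:
  fixes f g :: "nat \<Rightarrow> real"
  assumes eq: "\<And>k. K \<le> k \<Longrightarrow> f k = g k" and g: "(\<lambda>n. (\<Sum>k=1..n. g k) / n) \<longlonglongrightarrow> 0"
  shows "(\<lambda>n. (\<Sum>k=1..n. f k) / n) \<longlonglongrightarrow> 0"
proof -
  define c where "c = (\<Sum>k=1..K. f k - g k)"
  have "(\<lambda>n. (\<Sum>k=1..n. g k) / n + c / n) \<longlonglongrightarrow> 0 + 0"
    by (intro tendsto_add g lim_const_over_n)
  moreover have "eventually (\<lambda>n. (\<Sum>k=1..n. g k) / n + c / n = (\<Sum>k=1..n. f k) / n) sequentially"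
    using eventually_ge_at_top[of K]
  proof eventually_elim
    case (elim n)
    have "c = (\<Sum>k=1..n. f k - g k)"
      unfolding c_def using elim eq by (intro sum.mono_neutral_left) auto
    then show ?case by (simp add: sum_subtractf diff_divide_distrib)
  qed
  ultimately show ?thesis by (simp add: tendsto_cong)
qed

lemma sum_shift_pred:
  fixes f :: "nat \<Rightarrow> real"
  shows "(\<Sum>k=1..n. f k) = (\<Sum>k=1..n. f (k - 1)) + f n - f 0"
  by (induction n) auto

text \<open>Summed residuals telescope to (1 - \<alpha>) times the sum of the states, up to boundary
  and drift terms, so the average state is at most L/2. Markov's inequality for the counting measure
  then puts half of the times below L.\<close>

lemma occupation_of_bounded_set:
  fixes x :: "nat \<Rightarrow> nat" and \<alpha> \<mu> L :: real
  assumes lln: "(\<lambda>n. (\<Sum>k=1..n. real (x k) - \<alpha> * x (k - 1) - \<mu>) / n) \<longlonglongrightarrow> 0"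
    and L: "0 < L" "2 * (\<mu> + 2) \<le> (1 - \<alpha>) * L" and \<alpha>: "\<alpha> < 1"
  shows "eventually (\<lambda>n. n / 2 \<le> (\<Sum>k=1..n. of_bool (real (x (k - 1)) \<le> L))) sequentially"
proof -
  have "eventually (\<lambda>n. (\<Sum>k=1..n. real (x k) - \<alpha> * x (k - 1) - \<mu>) / n < 1) sequentially"
    using lln by (rule order_tendstoD) simp
  then show ?thesis
    using eventually_gt_at_top[of 0] eventually_ge_at_top[of "x 0"]
  proof eventually_elim
    case (elim n)
    define S where "S = (\<Sum>k=1..n. real (x (k - 1)))"
    have "(\<Sum>k=1..n. real (x k) - \<alpha> * x (k - 1) - \<mu>) \<le> n"
      using elim by (simp add: field_simps)
    moreover have "(\<Sum>k=1..n. real (x k) - \<alpha> * x (k - 1) - \<mu>) = (S + x n - x 0) - \<alpha> * S - n * \<mu>"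
      unfolding sum_subtractf S_def sum_shift_pred[of "\<lambda>k. real (x k)"] sum_distrib_left by simp
    \<comment> \<open>The 2 consists of 1 for the average residual and 1 for x 0, which is at most n
      by now.\<close>
    ultimately have S: "(1 - \<alpha>) * S \<le> n * (\<mu> + 2)"
      using elim by (simp add: algebra_simps)
    have "(1 - \<alpha>) * (2 * S) \<le> n * (2 * (\<mu> + 2))" using S by (simp add: algebra_simps)
    also have "\<dots> \<le> n * ((1 - \<alpha>) * L)" using L by (intro mult_left_mono) auto
    finally have "(1 - \<alpha>) * (2 * S) \<le> (1 - \<alpha>) * (n * L)" by (simp add: mult_ac)
    then have "2 * S \<le> n * L" using \<alpha> by simp
    then have "S / L \<le> n / 2" using L by (simp add: field_simps)
    then have "n / 2 \<le> n - S / L" by linarith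
    also have "\<dots> = (\<Sum>k=1..n. 1 - real (x (k - 1)) / L)"
      by (simp add: sum_subtractf S_def sum_divide_distrib)
    also have "\<dots> \<le> (\<Sum>k=1..n. of_bool (real (x (k - 1)) \<le> L))"
      using L by (intro sum_mono) (auto simp: field_simps)
    finally show ?case .
  qed
qed

text \<open>The frequency of i agrees asymptotically with the averaged transition probabilities,
  which are at least p at each visit to A. Of p * a * n, a quarter is lost to the law of large
  numbers and at most half to the index shift, which costs 1; hence the factor 1/4.\<close>

lemma occupation_propagates:
  fixes x :: "nat \<Rightarrow> nat" and \<pi> :: "nat \<Rightarrow> nat \<Rightarrow> real" and a p :: real
  assumes lln: "(\<lambda>n. (\<Sum>k=1..n. of_bool (x k = i) - \<pi> (k - 1) (x (k - 1))) / n) \<longlonglongrightarrow> 0"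
    and \<pi>: "\<And>k z. 0 \<le> \<pi> k z" "\<And>k z. z \<in> A \<Longrightarrow> p \<le> \<pi> k z" and p: "0 < p" and a: "0 < a"
    and dens: "eventually (\<lambda>n. a * n \<le> (\<Sum>k=1..n. of_bool (x (k - 1) \<in> A))) sequentially"
  shows "eventually (\<lambda>n. p * a / 4 * n \<le> (\<Sum>k=1..n. of_bool (x (k - 1) = i))) sequentially"
proof -
  have pa: "0 < p * a" using p a by simp
  have "eventually (\<lambda>n. - (p * a / 4) < (\<Sum>k=1..n. of_bool (x k = i) - \<pi> (k - 1) (x (k - 1))) / n) sequentially"
    using lln by (rule order_tendstoD) (use pa in simp)
  moreover have "eventually (\<lambda>n. 2 / (p * a) \<le> real n) sequentially"
    using filterlim_real_sequentially unfolding filterlim_at_top by blast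
  ultimately show ?thesis using dens eventually_gt_at_top[of 0]
  proof eventually_elim
    case (elim n)
    have 1: "2 \<le> p * a * n" using elim(2) pa by (simp add: field_simps)
    have 2: "- (p * a / 4) * n \<le> (\<Sum>k=1..n. of_bool (x k = i) - \<pi> (k - 1) (x (k - 1)))"
      using elim(1,4) by (simp add: field_simps)
    have "p * (a * n) \<le> p * (\<Sum>k=1..n. of_bool (x (k - 1) \<in> A))"
      using elim(3) p by (intro mult_left_mono) auto
    also have "\<dots> \<le> (\<Sum>k=1..n. \<pi> (k - 1) (x (k - 1)))"
      unfolding sum_distrib_left using \<pi> by (intro sum_mono) auto
    finally have 3: "p * (a * n) \<le> (\<Sum>k=1..n. \<pi> (k - 1) (x (k - 1)))" .
    have "(\<Sum>k=1..n. of_bool (x k = i) :: real) \<le> (\<Sum>k=1..n. of_bool (x (k - 1) = i)) + 1"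
      unfolding sum_shift_pred[of "\<lambda>k. of_bool (x k = i)"] by simp
    with 2 3 have 4: "p * (a * n) - p * a / 4 * n - 1 \<le> (\<Sum>k=1..n. of_bool (x (k - 1) = i))"
      unfolding sum_subtractf by linarith
    have "p * (a * n) = p * a * n" "p * a / 4 * n = p * a * n / 4" by auto
    with 1 4 show ?case by linarith
  qed
qed

text \<open>An affine function is determined by its values P and Q at e and e + 1: u = Q - P and v =
  P * (1 + e) - Q * e. Each of u^2, v^2 is then at most 2 * (1 + e)^2 * (P^2 + Q^2).\<close>

lemma two_point_quadratic_form_ge:
  fixes u v e :: real
  assumes "0 \<le> e"
  shows "(u\<^sup>2 + v\<^sup>2) / (4 * (1 + e)\<^sup>2) \<le> (u * e + v)\<^sup>2 + (u * (e + 1) + v)\<^sup>2"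
proof -
  define P Q where "P = u * e + v" and "Q = u * (e + 1) + v"
  have u: "u = Q - P" and v: "v = P * (1 + e) - Q * e"
    by (auto simp: P_def Q_def algebra_simps)
  have diff: "(r - q)\<^sup>2 \<le> 2 * r\<^sup>2 + 2 * q\<^sup>2" for r q :: real
    using zero_le_power2[of "r + q"] by (simp add: power2_eq_square algebra_simps)
  have e1: "1 \<le> (1 + e)\<^sup>2" "e\<^sup>2 \<le> (1 + e)\<^sup>2"
    using assms by (auto intro: power_mono one_le_power)
  have "u\<^sup>2 \<le> 2 * (P\<^sup>2 + Q\<^sup>2)" using diff[of Q P] by (simp add: u)
  also have "\<dots> \<le> 2 * ((1 + e)\<^sup>2 * (P\<^sup>2 + Q\<^sup>2))"
    using mult_right_mono[OF e1(1), of "P\<^sup>2 + Q\<^sup>2"] by simp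
  finally have 1: "u\<^sup>2 \<le> 2 * ((1 + e)\<^sup>2 * (P\<^sup>2 + Q\<^sup>2))" .
  have "v\<^sup>2 \<le> 2 * ((1 + e)\<^sup>2 * P\<^sup>2) + 2 * (e\<^sup>2 * Q\<^sup>2)"
    using diff[of "P * (1 + e)" "Q * e"] by (simp add: v power_mult_distrib mult.commute)
  also have "\<dots> \<le> 2 * ((1 + e)\<^sup>2 * P\<^sup>2) + 2 * ((1 + e)\<^sup>2 * Q\<^sup>2)"
    using mult_right_mono[OF e1(2), of "Q\<^sup>2"] by simp
  finally have "u\<^sup>2 + v\<^sup>2 \<le> 4 * ((1 + e)\<^sup>2 * (P\<^sup>2 + Q\<^sup>2))"
    using 1 by (simp add: distrib_left)
  moreover have "0 < 4 * (1 + e)\<^sup>2" using assms by simp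
  ultimately show ?thesis
    unfolding P_def[symmetric] Q_def[symmetric] by (subst pos_divide_le_eq) (auto simp: mult_ac)
qed

section \<open>Strong laws along the process\<close>

context inar_process
begin

text \<open>If d has mean zero from every frozen state, its values along the process are orthogonal
  to each bounded weight from the past, hence martingale differences; w bounds their conditional
  variances.\<close>

lemma history_step_strong_law:
  fixes d :: "nat \<Rightarrow> nat \<Rightarrow> nat \<Rightarrow> real" and w :: "nat \<Rightarrow> nat \<Rightarrow> real"
  assumes sq: "\<And>k x. integrable M (\<lambda>\<omega>. (d k x (offspring k x \<omega>))\<^sup>2)"
    and mean: "\<And>k x. expectation (\<lambda>\<omega>. d k x (offspring k x \<omega>)) = 0"
    and w: "\<And>k x. expectation (\<lambda>\<omega>. (d k x (offspring k x \<omega>))\<^sup>2) \<le> w k x" "\<And>k x. 0 \<le> w k x"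
      "\<And>k. integrable M (\<lambda>\<omega>. w k (X k \<omega>))"
      "\<And>k. expectation (\<lambda>\<omega>. w k (X k \<omega>)) \<le> C * real (Suc k) powr \<gamma>"
    and \<gamma>: "0 \<le> \<gamma>" "\<gamma> < 1"
  shows "AE \<omega> in M. (\<lambda>n. (\<Sum>k=1..n. d (k - 1) (X (k - 1) \<omega>) (X k \<omega>)) / n) \<longlonglongrightarrow> 0"
proof -
  define D where "D = (\<lambda>k \<omega>. d (k - 1) (X (k - 1) \<omega>) (X k \<omega>))"
  have D_Suc: "D (Suc k) = (\<lambda>\<omega>. d k (X k \<omega>) (X (Suc k) \<omega>))" for k
    by (simp add: D_def del: inarX.simps)
  have adapted: "D (Suc k) \<in> borel_measurable (history (Suc k))" for k
    unfolding D_Suc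
    by (rule measurable_compose_countable[OF _ generated_mono_measurable[OF past_mono X_history]],
        rule measurable_compose_countable[OF _ X_history]) simp
  note step = history_step_second_moment[OF w(3,2) sq w(1)]
  have D_sq: "integrable M (\<lambda>\<omega>. (D (Suc k) \<omega>)\<^sup>2)" for k
    unfolding D_Suc by (rule step(1))
  have D_int: "integrable M (D (Suc k))" for k
    by (rule square_integrable_imp_integrable[OF generated_measurable[OF past_subset adapted] D_sq])
  interpret square_integrable_martingale_differences M history D
  proof
    fix k and Z :: "'a \<Rightarrow> real"
    assume Z: "Z \<in> borel_measurable (history k)" and "bounded (range Z)"
    then obtain b where b: "\<And>\<omega>. \<bar>Z \<omega>\<bar> \<le> b" by (auto simp: bounded_iff)
    have "integrable M (\<lambda>\<omega>. Z \<omega> * D (Suc k) \<omega>)"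
    proof (rule Bochner_Integration.integrable_bound[OF integrable_mult_right[OF integrable_abs[OF D_int], of b]])
      show "(\<lambda>\<omega>. Z \<omega> * D (Suc k) \<omega>) \<in> borel_measurable M"
        using generated_measurable[OF past_subset Z] generated_measurable[OF past_subset adapted]
        by (rule borel_measurable_times)
      show "AE \<omega> in M. norm (Z \<omega> * D (Suc k) \<omega>) \<le> norm (b * \<bar>D (Suc k) \<omega>\<bar>)"
      proof (rule AE_I2)
        fix \<omega>
        have "\<bar>Z \<omega>\<bar> * \<bar>D (Suc k) \<omega>\<bar> \<le> \<bar>b\<bar> * \<bar>D (Suc k) \<omega>\<bar>"
          using b[of \<omega>] by (intro mult_right_mono) auto
        then show "norm (Z \<omega> * D (Suc k) \<omega>) \<le> norm (b * \<bar>D (Suc k) \<omega>\<bar>)"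
          by (simp add: abs_mult)
      qed
    qed
    then show "expectation (\<lambda>\<omega>. Z \<omega> * D (Suc k) \<omega>) = 0"
      using integral_history_step[OF Z, of "d k"] mean by (simp add: D_Suc del: inarX.simps)
  qed (use adapted D_sq sets_generated_subset[OF past_subset] generated_mono[OF past_mono] in
      \<open>auto simp: space_generated\<close>)
  have "expectation (\<lambda>\<omega>. (D (Suc k) \<omega>)\<^sup>2) \<le> C * real (Suc k) powr \<gamma>" for k
    unfolding D_Suc using step(2) w(4) by (rule order_trans)
  from strong_law_of_large_numbers[OF \<gamma> this] show ?thesis by (simp add: D_def del: inarX.simps)
qed

lemma residual_strong_law:
  "AE \<omega> in M. (\<lambda>n. (\<Sum>k=1..n. real (X k \<omega>) - \<alpha> * real (X (k - 1) \<omega>) - \<mu>) / n) \<longlonglongrightarrow> 0"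
proof -
  obtain B where B: "0 \<le> B" "\<And>k. integrable M (\<lambda>\<omega>. (real (X k \<omega>))\<^sup>2)"
    "\<And>k. expectation (\<lambda>\<omega>. (real (X k \<omega>))\<^sup>2) \<le> B"
    using X_second_moment_bounded by metis
  have int: "integrable M (\<lambda>\<omega>. real (X k \<omega>))" for k
    by (rule square_integrable_imp_integrable[OF _ B(2)]) measurable
  have le: "expectation (\<lambda>\<omega>. real (X k \<omega>)) \<le> B" for k
  proof -
    have "real n \<le> (real n)\<^sup>2" for n by (cases n) (auto simp: power2_eq_square)
    then have "expectation (\<lambda>\<omega>. real (X k \<omega>)) \<le> expectation (\<lambda>\<omega>. (real (X k \<omega>))\<^sup>2)"
      by (intro integral_mono int B)
    with B(3)[of k] show ?thesis by linarith
  qed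
  show ?thesis
    by (rule history_step_strong_law[where d="\<lambda>k x v. real v - \<alpha> * x - \<mu>" and w="\<lambda>k x. real x + eps_var"
          and \<gamma>=0 and C="B + eps_var", OF offspring_square_integrable offspring_mean offspring_variance])
       (use eps_var_nonneg le int in \<open>auto simp: prob_space\<close>)
qed

text \<open>Chebyshev and Borel-Cantelli. The exponent 3/4 lies above 1/2, so that its double is
  summable, and below 1, as the strong law demands of the variances.\<close>

lemma X_growth: "AE \<omega> in M. eventually (\<lambda>k. real (X k \<omega>) \<le> real (Suc k) powr (3/4)) sequentially"
proof -
  obtain B where B: "0 \<le> B" "\<And>k. integrable M (\<lambda>\<omega>. (real (X k \<omega>))\<^sup>2)"
    "\<And>k. expectation (\<lambda>\<omega>. (real (X k \<omega>))\<^sup>2) \<le> B"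
    using X_second_moment_bounded by metis
  define A where "A = (\<lambda>k. {\<omega> \<in> space M. (real (Suc k) powr (3/4))\<^sup>2 \<le> (real (X k \<omega>))\<^sup>2})"
  have A: "prob (A k) \<le> B * real (Suc k) powr (-3/2)" for k
  proof -
    have sq: "(real (Suc k) powr (3/4))\<^sup>2 = real (Suc k) powr (3/2)"
      by (simp add: power2_eq_square flip: powr_add)
    have "prob (A k) \<le> expectation (\<lambda>\<omega>. (real (X k \<omega>))\<^sup>2) / (real (Suc k) powr (3/4))\<^sup>2"
      unfolding A_def using B(2)[of k] by (intro integral_Markov_inequality_measure[where A="{}"]) auto
    also have "\<dots> \<le> B / (real (Suc k) powr (3/4))\<^sup>2"
      by (intro divide_right_mono B) auto
    also have "\<dots> = B * real (Suc k) powr (-3/2)"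
      unfolding sq by (simp add: powr_minus field_simps)
    finally show ?thesis .
  qed
  have sum: "summable (\<lambda>k. prob (A k))"
  proof (rule summable_comparison_test'[where N=0])
    have "summable (\<lambda>k. real (Suc k) powr (-3/2))"
      unfolding summable_Suc_iff[of "\<lambda>k. real k powr (-3/2)"] summable_real_powr_iff by simp
    then show "summable (\<lambda>k. B * real (Suc k) powr (-3/2))" by (rule summable_mult)
  qed (use A in simp)
  have meas: "A k \<in> sets M" for k unfolding A_def by measurable
  have "AE \<omega> in M. eventually (\<lambda>k. \<omega> \<in> space M - A k) sequentially"
    by (rule borel_cantelli_AE1[OF meas _ sum]) (simp add: emeasure_eq_measure)
  then show ?thesis
  proof eventually_elim
    case (elim \<omega>)
    then show ?case
    proof eventually_elim
      case (elim k)
      then have "(real (X k \<omega>))\<^sup>2 \<le> (real (Suc k) powr (3/4))\<^sup>2" by (auto simp: A_def)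
      then show ?case by (rule power2_le_imp_le) simp
    qed
  qed
qed

text \<open>With only second moments of \<open>X\<close> available the products \<open>residual * X\<close> need not be square
  integrable; truncating \<open>X\<close> at the previsible level \<open>k powr (3/4)\<close> keeps the martingale property
  and gives second moments of sublinear growth.\<close>

lemma residual_covariance_strong_law:
  "AE \<omega> in M. (\<lambda>n. (\<Sum>k=1..n. (real (X k \<omega>) - \<alpha> * real (X (k - 1) \<omega>) - \<mu>) * real (X (k - 1) \<omega>)) / n) \<longlonglongrightarrow> 0"
proof -
  obtain B where B: "0 \<le> B" "\<And>k. integrable M (\<lambda>\<omega>. (real (X k \<omega>))\<^sup>2)"
    "\<And>k. expectation (\<lambda>\<omega>. (real (X k \<omega>))\<^sup>2) \<le> B"
    using X_second_moment_bounded by metis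
  define b where "b = (\<lambda>k. real (Suc k) powr (3/4))"
  define g where "g = (\<lambda>k x. if real x \<le> b k then real x else 0)"
  \<comment> \<open>The transition variance is at most x + \<open>eps_var\<close>; where
    \<open>g\<close> is nonzero, x is at most \<open>b k\<close>. Only the remaining square of x
    meets the second moment bound.\<close>
  define w where "w = (\<lambda>k x. (b k + eps_var) * (real x)\<^sup>2)"
  have b1: "1 \<le> b k" for k unfolding b_def by (rule ge_one_powr_ge_zero) auto
  have sq: "((real (offspring k x \<omega>) - \<alpha> * x - \<mu>) * g k x)\<^sup>2
      = (real (offspring k x \<omega>) - \<alpha> * x - \<mu>)\<^sup>2 * (g k x)\<^sup>2" for k x \<omega>
    by (rule power_mult_distrib)
  have "AE \<omega> in M. (\<lambda>n. (\<Sum>k=1..n. (real (X k \<omega>) - \<alpha> * real (X (k - 1) \<omega>) - \<mu>) * g (k - 1) (X (k - 1) \<omega>)) / n) \<longlonglongrightarrow> 0"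
  proof (rule history_step_strong_law[where d="\<lambda>k x v. (real v - \<alpha> * x - \<mu>) * g k x" and w=w
        and C="(1 + eps_var) * B" and \<gamma>="3/4"])
    fix k x
    show "integrable M (\<lambda>\<omega>. ((real (offspring k x \<omega>) - \<alpha> * x - \<mu>) * g k x)\<^sup>2)"
      unfolding sq using offspring_square_integrable by simp
    show "expectation (\<lambda>\<omega>. (real (offspring k x \<omega>) - \<alpha> * x - \<mu>) * g k x) = 0"
      using offspring_mean offspring_integrable by simp
    show "0 \<le> w k x" using b1[of k] eps_var_nonneg by (simp add: w_def)
    have "expectation (\<lambda>\<omega>. ((real (offspring k x \<omega>) - \<alpha> * x - \<mu>) * g k x)\<^sup>2) \<le> (x + eps_var) * (g k x)\<^sup>2"
      unfolding sq using offspring_square_integrable offspring_variance by (simp add: mult_right_mono)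
    also have "\<dots> \<le> w k x"
      using eps_var_nonneg b1[of k] by (auto simp: g_def w_def intro!: mult_right_mono)
    finally show "expectation (\<lambda>\<omega>. ((real (offspring k x \<omega>) - \<alpha> * x - \<mu>) * g k x)\<^sup>2) \<le> w k x" .
  next
    fix k
    show "integrable M (\<lambda>\<omega>. w k (X k \<omega>))" using B(2)[of k] by (simp add: w_def)
    have "expectation (\<lambda>\<omega>. w k (X k \<omega>)) = (b k + eps_var) * expectation (\<lambda>\<omega>. (real (X k \<omega>))\<^sup>2)"
      by (simp add: w_def)
    also have "\<dots> \<le> ((1 + eps_var) * b k) * B"
    proof (rule mult_mono)
      show "b k + eps_var \<le> (1 + eps_var) * b k"
        using mult_left_mono[OF b1[of k] eps_var_nonneg] by (simp add: algebra_simps)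
    qed (use B b1[of k] eps_var_nonneg in auto)
    finally show "expectation (\<lambda>\<omega>. w k (X k \<omega>)) \<le> (1 + eps_var) * B * real (Suc k) powr (3/4)"
      by (simp add: b_def mult_ac)
  qed auto
  then show ?thesis using X_growth
  proof eventually_elim
    case (elim \<omega>)
    obtain K where K: "\<And>k. K \<le> k \<Longrightarrow> real (X k \<omega>) \<le> b k"
      using elim(2) unfolding eventually_sequentially b_def by blast
    show ?case
      \<comment> \<open>The truncation acts on the state at k - 1, hence the shift by one.\<close>
      by (rule average_tendsto_eventually_cong[OF _ elim(1), of "Suc K"])
         (use K in \<open>auto simp: g_def\<close>)
  qed
qed

text \<open>An indicator minus its conditional probability given the previous state: centred and
  bounded by 1. That probability depends on \<omega> only through the state; \<omega>' is integrated
  out.\<close>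

lemma occupation_strong_law:
  "AE \<omega> in M. (\<lambda>n. (\<Sum>k=1..n. of_bool (X k \<omega> = i)
    - prob {\<omega>' \<in> space M. offspring (k - 1) (X (k - 1) \<omega>) \<omega>' = i}) / n) \<longlonglongrightarrow> 0"
proof (rule history_step_strong_law[where
      d="\<lambda>k x v. of_bool (v = i) - prob {\<omega>' \<in> space M. offspring k x \<omega>' = i}" and w="\<lambda>_ _. 1" and C=1 and \<gamma>=0])
  fix k x
  let ?p = "prob {\<omega>' \<in> space M. offspring k x \<omega>' = i}"
  have m: "(\<lambda>\<omega>. of_bool (offspring k x \<omega> = i) :: real) \<in> borel_measurable M" by measurable
  have i: "integrable M (\<lambda>\<omega>. of_bool (offspring k x \<omega> = i) :: real)"
    by (rule integrable_const_bound[where B=1, OF _ m]) auto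
  have "?p = expectation (indicator {\<omega>' \<in> space M. offspring k x \<omega>' = i})" by simp
  also have "\<dots> = expectation (\<lambda>\<omega>. of_bool (offspring k x \<omega> = i))"
    by (rule Bochner_Integration.integral_cong) (auto simp: indicator_def)
  finally have p: "?p = expectation (\<lambda>\<omega>. of_bool (offspring k x \<omega> = i))" .
  then show "expectation (\<lambda>\<omega>. of_bool (offspring k x \<omega> = i) - ?p) = 0"
    using i by (simp add: prob_space)
  have le: "(of_bool (offspring k x \<omega> = i) - ?p)\<^sup>2 \<le> 1" for \<omega>
    using measure_nonneg[of M "{\<omega>' \<in> space M. offspring k x \<omega>' = i}"] prob_le_1[of "{\<omega>' \<in> space M. offspring k x \<omega>' = i}"]
    by (auto simp: abs_square_le_1)
  have m2: "(\<lambda>\<omega>. (of_bool (offspring k x \<omega> = i) - ?p)\<^sup>2) \<in> borel_measurable M" using m by measurable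
  show int: "integrable M (\<lambda>\<omega>. (of_bool (offspring k x \<omega> = i) - ?p)\<^sup>2)"
    by (rule integrable_const_bound[where B=1, OF _ m2]) (use le in auto)
  have "expectation (\<lambda>\<omega>. (of_bool (offspring k x \<omega> = i) - ?p)\<^sup>2) \<le> expectation (\<lambda>_. 1)"
    by (intro integral_mono int le) simp
  then show "expectation (\<lambda>\<omega>. (of_bool (offspring k x \<omega> = i) - ?p)\<^sup>2) \<le> 1"
    by (simp add: prob_space)
qed (auto simp: prob_space)

section \<open>Visits to two neighbouring states\<close>

lemma eps_positive_atom: obtains e where "1 \<le> e" "0 < prob {\<omega> \<in> space M. eps 1 \<omega> = e}"
proof (rule ccontr)
  assume "\<not> thesis"
  then have null: "prob {\<omega> \<in> space M. eps 1 \<omega> = Suc e} = 0" for e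
    using that[of "Suc e"] by (metis le_add1 plus_1_eq_Suc zero_less_measure_iff)
  have e1: "eps 1 \<in> measurable M (count_space UNIV)" using eps_measurable[of 0] by simp
  have "{\<omega> \<in> space M. eps 1 \<omega> = Suc e} \<in> null_sets M" for e
    using null[of e] measurable_sets[OF e1, of "{Suc e}"]
    by (auto simp: null_sets_def emeasure_eq_measure vimage_def Int_def conj_commute)
  then have "(\<Union>e. {\<omega> \<in> space M. eps 1 \<omega> = Suc e}) \<in> null_sets M" by (rule null_sets_UN)
  also have "(\<Union>e. {\<omega> \<in> space M. eps 1 \<omega> = Suc e}) = {\<omega> \<in> space M. eps 1 \<omega> \<noteq> 0}"
    by (auto simp: gr0_conv_Suc)
  finally show False using eps_nonzero by (simp add: measure_def null_sets_def)
qed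

lemma occupation_of_two_points:
  obtains e :: nat and a :: real where "0 < a"
    "AE \<omega> in M. eventually (\<lambda>n. a * n \<le> (\<Sum>k=1..n. of_bool (X (k - 1) \<omega> = e)) \<and>
       a * n \<le> (\<Sum>k=1..n. of_bool (X (k - 1) \<omega> = Suc e))) sequentially"
proof -
  obtain e where e: "1 \<le> e" and pe: "0 < prob {\<omega> \<in> space M. eps 1 \<omega> = e}"
    using eps_positive_atom .
  define q where "q = prob {\<omega> \<in> space M. eps 1 \<omega> = e}"
  define m where "m = min \<alpha> (1 - \<alpha>)"
  have q: "0 < q" and m: "0 < m" "m \<le> 1" using pe \<alpha> by (auto simp: q_def m_def)
  \<comment> \<open>Large enough for \<open>occupation_of_bounded_set\<close>, and a natural number
    so that it can serve as an exponent of m.\<close>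
  define L where "L = nat \<lceil>2 * (\<mu> + 2) / (1 - \<alpha>)\<rceil> + 1"
  have "0 < L" unfolding L_def by linarith
  then have L0: "0 < real L" by simp
  have L: "2 * (\<mu> + 2) \<le> (1 - \<alpha>) * real L"
  proof -
    have "2 * (\<mu> + 2) / (1 - \<alpha>) \<le> real L" unfolding L_def by linarith
    then show ?thesis using \<alpha> by (simp add: pos_divide_le_eq mult.commute)
  qed
  define \<pi> where "\<pi> = (\<lambda>i k x. prob {\<omega> \<in> space M. offspring k x \<omega> = i})"
  have \<pi>0: "0 \<le> \<pi> i k x" for i k x by (simp add: \<pi>_def)
  have \<pi>1: "q * m ^ L \<le> \<pi> e k x" if "x \<in> {x. real x \<le> real L}" for k x
  proof -
    have "q * m ^ L \<le> q * m ^ x" using that m q by (intro mult_left_mono power_decreasing) auto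
    also have "\<dots> \<le> \<pi> e k x"
      using offspring_prob_ge[of "\<lambda>_. 0" e x k] by (simp add: q_def m_def \<pi>_def)
    finally show ?thesis .
  qed
  have \<pi>2: "q * m ^ e \<le> \<pi> (Suc e) k x" if "x \<in> {e}" for k x
  proof -
    \<comment> \<open>Exactly one of the e individuals survives and e immigrants arrive; this is
      where e >= 1 enters.\<close>
    have "(\<Sum>j=1..e. of_bool (j = 1)) = (1::nat)" using e by (simp add: of_bool_def)
    then show ?thesis
      using offspring_prob_ge[of "\<lambda>j. of_bool (j = 1)" e e k] that by (simp add: q_def m_def \<pi>_def)
  qed
  \<comment> \<open>Two propagations: from the states up to L, of density 1/2, to e; then from e, of
    density \<open>p1\<close>, to e + 1.\<close>
  define p1 p2 where "p1 = q * m ^ L * (1 / 2) / 4" and "p2 = q * m ^ e * p1 / 4"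
  have p: "0 < p1" "0 < p2" using q m by (auto simp: p1_def p2_def)
  have "AE \<omega> in M. eventually (\<lambda>n. min p1 p2 * n \<le> (\<Sum>k=1..n. of_bool (X (k - 1) \<omega> = e)) \<and>
       min p1 p2 * n \<le> (\<Sum>k=1..n. of_bool (X (k - 1) \<omega> = Suc e))) sequentially"
    using residual_strong_law occupation_strong_law[of e] occupation_strong_law[of "Suc e"]
  proof eventually_elim
    case (elim \<omega>)
    have "eventually (\<lambda>n. n / 2 \<le> (\<Sum>k=1..n. of_bool (real (X (k - 1) \<omega>) \<le> real L))) sequentially"
      by (rule occupation_of_bounded_set[OF elim(1) L0 L \<alpha>(2)])
    then have 0: "eventually (\<lambda>n. 1 / 2 * real n \<le> (\<Sum>k=1..n. of_bool (X (k - 1) \<omega> \<in> {x. real x \<le> real L}))) sequentially"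
      by simp
    have lln: "(\<lambda>n. (\<Sum>k=1..n. of_bool (X k \<omega> = i) - \<pi> i (k - 1) (X (k - 1) \<omega>)) / n) \<longlonglongrightarrow> 0"
      if "i = e \<or> i = Suc e" for i
      using that elim(2,3) unfolding \<pi>_def by auto
    have 1: "eventually (\<lambda>n. p1 * n \<le> (\<Sum>k=1..n. of_bool (X (k - 1) \<omega> = e))) sequentially"
      unfolding p1_def
      by (rule occupation_propagates[where x="\<lambda>k. X k \<omega>" and \<pi>="\<pi> e", OF lln \<pi>0 \<pi>1 _ _ 0]) (use q m in auto)
    then have 2: "eventually (\<lambda>n. p1 * n \<le> (\<Sum>k=1..n. of_bool (X (k - 1) \<omega> \<in> {e}))) sequentially"
      by simp
    have "eventually (\<lambda>n. p2 * n \<le> (\<Sum>k=1..n. of_bool (X (k - 1) \<omega> = Suc e))) sequentially"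
      unfolding p2_def
      by (rule occupation_propagates[where x="\<lambda>k. X k \<omega>" and \<pi>="\<pi> (Suc e)", OF lln \<pi>0 \<pi>2 _ p(1) 2]) (use q m in auto)
    with 1 show ?case
    proof eventually_elim
      case (elim n)
      have "min p1 p2 * n \<le> p1 * n" "min p1 p2 * n \<le> p2 * n" by (auto intro: mult_right_mono)
      with elim show ?case by linarith
    qed
  qed
  with p show ?thesis by (intro that[of "min p1 p2" e]) auto
qed

text \<open>Y differs from X only at s, and the omitted indices s and s + 1 are the ones whose
  residuals read that value; each hypothesis thus reduces to one on X.\<close>

lemma outlier_regression_AE:
  obtains c where "AE \<omega> in M. outlier_regression s (\<lambda>k. real (inarY X0 eps xi s \<theta> k \<omega>)) \<alpha> \<mu> c"
proof -
  obtain e :: nat and a :: real where a: "0 < a" and occ: "AE \<omega> in M. eventually (\<lambda>n. a * n \<le> (\<Sum>k=1..n. of_bool (X (k - 1) \<omega> = e)) \<and>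
       a * n \<le> (\<Sum>k=1..n. of_bool (X (k - 1) \<omega> = Suc e))) sequentially"
    using occupation_of_two_points .
  \<comment> \<open>Density a/2 of each of the two states once two indices are dropped, times the
    constant of \<open>two_point_quadratic_form_ge\<close>.\<close>
  define c where "c = a / 2 / (4 * (1 + real e)\<^sup>2)"
  have "AE \<omega> in M. outlier_regression s (\<lambda>k. real (inarY X0 eps xi s \<theta> k \<omega>)) \<alpha> \<mu> c"
    using residual_strong_law residual_covariance_strong_law occ
  proof eventually_elim
    case (elim \<omega>)
    define y where "y = (\<lambda>k. real (inarY X0 eps xi s \<theta> k \<omega>))"
    define x where "x = (\<lambda>k. X k \<omega>)"
    have y: "y k = real (x k)" if "k \<noteq> s" for k
      using that by (simp add: y_def x_def inarY_def del: inarX.simps)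
    have restrict: "(\<Sum>k\<in>{1..n} - {s, s+1}. f k) = (\<Sum>k=1..n. if k \<in> {s, s+1} then 0 else f k)"
      for n and f :: "nat \<Rightarrow> real"
      by (rule sum.mono_neutral_cong_left) auto
    have ydiff: "y k = real (x k) \<and> y (k - 1) = real (x (k - 1))" if "k \<notin> {s, s+1}" "1 \<le> k" for k
      using that by (auto intro!: y)
    show ?case
      unfolding y_def[symmetric]
    proof
      show "0 < c" using a by (simp add: c_def)
      show "(\<lambda>n. (\<Sum>k\<in>{1..n} - {s, s+1}. y k - \<alpha> * y (k-1) - \<mu>) / n) \<longlonglongrightarrow> 0"
        unfolding restrict
        by (rule average_tendsto_eventually_cong[where K="s + 2", OF _ elim(1)])
           (use ydiff in \<open>auto simp: x_def simp del: inarX.simps\<close>)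
      show "(\<lambda>n. (\<Sum>k\<in>{1..n} - {s, s+1}. (y k - \<alpha> * y (k-1) - \<mu>) * y (k-1)) / n) \<longlonglongrightarrow> 0"
        unfolding restrict
        by (rule average_tendsto_eventually_cong[where K="s + 2", OF _ elim(2)])
           (use ydiff in \<open>auto simp: x_def simp del: inarX.simps\<close>)
      have "eventually (\<lambda>n. 4 / a \<le> real n) sequentially"
        using filterlim_real_sequentially unfolding filterlim_at_top by blast
      moreover have "eventually (\<lambda>n. a * n \<le> (\<Sum>k=1..n. of_bool (x (k - 1) = e)) \<and>
          a * n \<le> (\<Sum>k=1..n. of_bool (x (k - 1) = Suc e))) sequentially"
        using elim(3) unfolding x_def .
      ultimately show "eventually (\<lambda>n. \<forall>u v. c * n * (u\<^sup>2 + v\<^sup>2)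
          \<le> (\<Sum>k\<in>{1..n} - {s, s+1}. (u * y (k-1) + v)\<^sup>2)) sequentially"
      proof (eventually_elim, intro allI)
        fix n u v
        assume n: "4 / a \<le> real n" and dens: "a * n \<le> (\<Sum>k=1..n. of_bool (x (k - 1) = e)) \<and>
          a * n \<le> (\<Sum>k=1..n. of_bool (x (k - 1) = Suc e))"
        let ?I = "{1..n} - {s, s+1}"
        \<comment> \<open>Pays for the at most two visits lost with the indices s and s + 1.\<close>
        have n': "2 \<le> a * n / 2" using n a by (simp add: field_simps)
        have drop: "a * n / 2 \<le> (\<Sum>k\<in>?I. of_bool (x (k - 1) = i))"
          if "a * n \<le> (\<Sum>k=1..n. of_bool (x (k - 1) = i))" for i
        proof -
          have "(\<Sum>k=1..n. of_bool (x (k - 1) = i) :: real) \<le> (\<Sum>k\<in>?I \<union> {s, s+1}. of_bool (x (k - 1) = i))"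
            by (intro sum_mono2) auto
          also have "\<dots> \<le> (\<Sum>k\<in>?I. of_bool (x (k - 1) = i)) + (\<Sum>k\<in>{s, s+1}. of_bool (x (k - 1) = i))"
            by (subst sum.union_disjoint) auto
          also have "(\<Sum>k\<in>{s, s+1}. of_bool (x (k - 1) = i)) \<le> (\<Sum>k\<in>{s, s+1}. 1 :: real)"
            by (intro sum_mono) auto
          also have "\<dots> = 2" by simp
          finally show ?thesis using that n' by linarith
        qed
        define P Q where "P = (u * real e + v)\<^sup>2" and "Q = (u * (real e + 1) + v)\<^sup>2"
        have PQ: "0 \<le> P" "0 \<le> Q" by (auto simp: P_def Q_def)
        have "c * n * (u\<^sup>2 + v\<^sup>2) = a * n / 2 * ((u\<^sup>2 + v\<^sup>2) / (4 * (1 + real e)\<^sup>2))"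
          by (simp add: c_def)
        also have "\<dots> \<le> a * n / 2 * (P + Q)"
          unfolding P_def Q_def using a by (intro mult_left_mono two_point_quadratic_form_ge) auto
        also have "\<dots> = a * n / 2 * P + a * n / 2 * Q" by (simp add: algebra_simps)
        also have "\<dots> \<le> (\<Sum>k\<in>?I. of_bool (x (k - 1) = e)) * P + (\<Sum>k\<in>?I. of_bool (x (k - 1) = Suc e)) * Q"
          using dens PQ by (intro add_mono mult_right_mono drop) auto
        also have "\<dots> = (\<Sum>k\<in>?I. of_bool (x (k - 1) = e) * P + of_bool (x (k - 1) = Suc e) * Q)"
          by (simp add: sum.distrib sum_distrib_right)
        also have "\<dots> \<le> (\<Sum>k\<in>?I. (u * y (k-1) + v)\<^sup>2)"
        proof (rule sum_mono)
          fix k assume "k \<in> ?I"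
          then have "y (k - 1) = real (x (k - 1))" using ydiff[of k] by auto
          then show "of_bool (x (k - 1) = e) * P + of_bool (x (k - 1) = Suc e) * Q \<le> (u * y (k-1) + v)\<^sup>2"
            by (auto simp: P_def Q_def add.commute)
        qed
        finally show "c * n * (u\<^sup>2 + v\<^sup>2) \<le> (\<Sum>k\<in>?I. (u * y (k-1) + v)\<^sup>2)" .
      qed
    qed
  qed
  then show ?thesis by (rule that)
qed

end

theorem theorem3p3p1:
  fixes M :: "'a measure"
    and X0 :: "'a \<Rightarrow> nat" and eps :: "nat \<Rightarrow> 'a \<Rightarrow> nat" and xi :: "nat \<Rightarrow> nat \<Rightarrow> 'a \<Rightarrow> nat"
    and \<alpha> :: real and s \<theta> :: nat
  assumes P: "prob_space M"
    and \<alpha>: "0 < \<alpha>" "\<alpha> < 1"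
    and indep: "prob_space.indep_vars M (\<lambda>_. count_space UNIV) (inar_family X0 eps xi) inar_indices"
    and eps_ident: "\<And>k. k \<ge> 1 \<Longrightarrow> distr M (count_space UNIV) (eps k) = distr M (count_space UNIV) (eps 1)"
    and eps_sq: "integrable M (\<lambda>\<omega>. (real (eps 1 \<omega>))\<^sup>2)"
    and eps_nonzero: "measure M {\<omega> \<in> space M. eps 1 \<omega> \<noteq> 0} > 0"
    and xi_bern: "\<And>k j. k \<ge> 1 \<Longrightarrow> j \<ge> 1 \<Longrightarrow>
        distr M (count_space UNIV) (xi k j) = measure_pmf (map_pmf (\<lambda>b. if b then 1 else 0) (bernoulli_pmf \<alpha>))"
    and X0_sq: "integrable M (\<lambda>\<omega>. (real (X0 \<omega>))\<^sup>2)"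
    and s: "s \<ge> 1"
    and \<theta>: "\<theta> \<ge> 1"
  shows "(AE \<omega> in M. \<exists>n0. \<forall>n \<ge> n0.
            is_unique_min (Qn s n (\<lambda>k. real (inarY X0 eps xi s \<theta> k \<omega>))))
    \<and> (AE \<omega> in M.
         let Y = (\<lambda>k. real (inarY X0 eps xi s \<theta> k \<omega>));
             \<mu> = integral\<^sup>L M (\<lambda>\<omega>. real (eps 1 \<omega>));
             est = (\<lambda>n. argminQ s n Y)
         in ((\<lambda>n. fst (est n)) \<longlonglongrightarrow> \<alpha>)
          \<and> ((\<lambda>n. fst (snd (est n))) \<longlonglongrightarrow> \<mu>)
          \<and> ((\<lambda>n. snd (snd (est n))) \<longlonglongrightarrow>
               Y s - \<alpha> / (1 + \<alpha>\<^sup>2) * (Y (s-1) + Y (s+1)) - (1 - \<alpha>) / (1 + \<alpha>\<^sup>2) * \<mu>))"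
proof -
  interpret inar_process M X0 eps xi \<alpha>
    using assms by (intro inar_process.intro inar_process_axioms.intro)
  obtain c where c: "AE \<omega> in M. outlier_regression s (\<lambda>k. real (inarY X0 eps xi s \<theta> k \<omega>)) \<alpha> \<mu> c"
    using outlier_regression_AE .
  show ?thesis
  proof
    from c show "AE \<omega> in M. \<exists>n0. \<forall>n \<ge> n0.
        is_unique_min (Qn s n (\<lambda>k. real (inarY X0 eps xi s \<theta> k \<omega>)))"
      by eventually_elim
        (use outlier_regression.eventually_unique_min in \<open>auto simp: eventually_sequentially\<close>)
    from c show "AE \<omega> in M.
         let Y = (\<lambda>k. real (inarY X0 eps xi s \<theta> k \<omega>));
             \<mu> = integral\<^sup>L M (\<lambda>\<omega>. real (eps 1 \<omega>));
             est = (\<lambda>n. argminQ s n Y)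
         in ((\<lambda>n. fst (est n)) \<longlonglongrightarrow> \<alpha>)
          \<and> ((\<lambda>n. fst (snd (est n))) \<longlonglongrightarrow> \<mu>)
          \<and> ((\<lambda>n. snd (snd (est n))) \<longlonglongrightarrow>
               Y s - \<alpha> / (1 + \<alpha>\<^sup>2) * (Y (s-1) + Y (s+1)) - (1 - \<alpha>) / (1 + \<alpha>\<^sup>2) * \<mu>)"
    proof eventually_elim
      case (elim \<omega>)
      interpret outlier_regression s "\<lambda>k. real (inarY X0 eps xi s \<theta> k \<omega>)" \<alpha> \<mu> c by (rule elim)
      show ?case
        using argmin_tendsto unfolding Let_def outlier_fit_def by blast
    qed
  qed
qed

end
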